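(* Let $d\ge2$ and let $\mathbb P$ be a probability measure on $\Omega=[0,\infty)^{E_d}$ that is stationary and ergodic with respect to translations of $\mathbb Z^d$, with $\mathbb E[\omega(e)]<\infty$ for all $e\in E_d$, such that $\mathcal C_\infty(\omega)$ is connected for $\mathbb P$-a.e. $\omega$, and $\mathbb P[0\in\mathcal C_\infty]>0$. Suppose that $\theta\in(0,1)$ is such that for $\mathbb P_0$-a.e. $\omega$ there exists $N_0(\omega)<\infty$ such that for all $n\ge N_0(\omega)$ the ball $B^\omega(0,n)$ is $\theta$-very regular, and assume that $\mathbb E[(1/\omega(e))\mathbf 1_{\omega(e)>0}]<\infty$ for all $e\in E_d$. Then the corrector $\chi=(\chi_1,\dots,\chi_d)$ satisfies, for any $j=1,\dots,d$, $$\lim_{n\to\infty}\frac1{|B^\omega(0,n)|}\sum_{x\in B^\omega(0,n)}\Big|\tfrac1n\chi_j(\omega,x)\Big|=0,\qquad \mathbb P_0\text{-a.s.}$$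
   Context: **Environment.** $(\mathbb Z^d,E_d)$ is the Euclidean lattice with the set $E_d$ of non-oriented nearest-neighbour edges; $\Omega=[0,\infty)^{E_d}$ carries the product Borel $\sigma$-algebra. $\mathbb E$ is expectation under $\mathbb P$. Shifts: $(\tau_z\omega)(\{x,y\})=\omega(\{x+z,y+z\})$. Open edges: $\mathcal O(\omega)=\{e\in E_d:\omega(e)>0\}$; $x\sim y$ means $\{x,y\}\in\mathcal O(\omega)$. $\mathcal C_\infty(\omega)$ is the set of vertices in infinite connected components of $(\mathbb Z^d,\mathcal O(\omega))$. $\mathbb P_0[\cdot]=\mathbb P[\cdot\mid0\in\mathcal C_\infty]$ with expectation $\mathbb E_0$. Convention: $(1/\omega(e))\mathbf 1_{\omega(e)>0}=0$ if $\omega(e)=0$. **Balls.** $d^\omega$ is the graph distance on $(\mathcal C_\infty(\omega),\mathcal O(\omega))$ and $B^\omega(x,r)=\{y\in\mathcal C_\infty(\omega):d^\omega(x,y)\le\lfloor r\rfloor\}$. For $A\subset B\subset\mathcal C_\infty(\omega)$, $\partial^\omega_BA=\{\{x,y\}\in\mathcal O(\omega):x\in A,\ y\in B\setminus A\}$. **Regular balls.** Fix deterministic constants $C_{\mathrm V}\in(0,1]$, $C_{\mathrm{riso}}\in(0,\infty)$, $C_{\mathrm W}\in[1,\infty)$. For $x\in\mathcal C_\infty(\omega)$ and $n\ge1$, $B^\omega(x,n)$ is *regular* if (i) $C_{\mathrm V}n^d\le|B^\omega(x,n)|$; and (ii) there is a connected set $\mathcal S^\omega(x,n)\subset\mathcal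 C_\infty(\omega)$ with $B^\omega(x,n)\subset\mathcal S^\omega(x,n)\subset B^\omega(x,C_{\mathrm W}n)$ and $|\partial^\omega_{\mathcal S^\omega(x,n)}A|\ge C_{\mathrm{riso}}n^{-1}|A|$ for every $A\subset\mathcal S^\omega(x,n)$ with $|A|\le\frac12|\mathcal S^\omega(x,n)|$. $B^\omega(0,n)$ is *$\theta$-very regular* if $B^\omega(x,r)$ is regular for every $x\in B^\omega(0,n)$ and every $r\ge n^{\theta/d}$. **Corrector.** A measurable $\Psi:\Omega\times\mathbb Z^d\to\mathbb R$ has the cocycle property if for $\mathbb P_0$-a.e. $\omega$, $\Psi(\tau_x\omega,y-x)=\Psi(\omega,y)-\Psi(\omega,x)$ for all $x,y\in\mathcal C_\infty(\omega)$. $L^2_{\mathrm{cov}}$ is the Hilbert space of such $\Psi$ with $\|\Psi\|_{L^2_{\mathrm{cov}}}^2:=\mathbb E_0[\sum_{x\sim0}\omega(\{0,x\})|\Psi(\omega,x)|^2]<\infty$ (functions agreeing for $\mathbb P_0$-a.e. $\omega$ on all of $\mathcal C_\infty(\omega)$ being identified), with the corresponding inner product. For bounded local $\varphi:\Omega\to\mathbb R$ (i.e. depending on finitely many edges) put $\mathrm D\varphi(\omega,x)=\varphi(\tau_x\omega)-\varphi(\omega)$. $L^2_{\mathrm{pot}}$ is the closure in $L^2_{\mathrm{cov}}$ of the set of all such $\mathrm D\varphi$ and $L^2_{\mathrm{sol}}$ its orthogonal complement. The position field components $\Pi_j(\omega,x)=x_j$ lie in $L^2_{\mathrm{cov}}$;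 write $\Pi_j=\chi_j+\Phi_j$ with $\chi_j\in L^2_{\mathrm{pot}}$, $\Phi_j\in L^2_{\mathrm{sol}}$. The corrector is $\chi=(\chi_1,\dots,\chi_d)$. *)

theory Defs
  imports "HOL-Probability.Probability"
begin

text \<open>
  The lattice is \<open>int ^ 'd\<close>, so the dimension is \<open>CARD('d)\<close>.  An environment assigns a weight
  to each unordered pair \<open>{x, y}\<close>; points of the sample space are extensional functions, i.e. they
  take the value \<open>undefined\<close> outside \<open>lattice_edges\<close>.
\<close>

type_synonym 'd env = "(int ^ 'd) set \<Rightarrow> real"

definition lattice_edges :: "(int ^ 'd::finite) set set" where
  "lattice_edges = {{x, y} | x y. (\<Sum>i\<in>UNIV. \<bar>x $ i - y $ i\<bar>) = 1}"

definition env_space :: "('d::finite) env measure" where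
  "env_space = (\<Pi>\<^sub>M e\<in>lattice_edges. restrict_space borel {0..})"

definition shift :: "int ^ 'd::finite \<Rightarrow> 'd env \<Rightarrow> 'd env" where
  "shift z \<omega> = (\<lambda>e\<in>lattice_edges. \<omega> ((\<lambda>x. x + z) ` e))"

definition stationary :: "('d::finite) env measure \<Rightarrow> bool" where
  "stationary P \<longleftrightarrow> (\<forall>z. distr P env_space (shift z) = P)"

definition ergodic :: "('d::finite) env measure \<Rightarrow> bool" where
  "ergodic P \<longleftrightarrow>
     (\<forall>A\<in>sets P. (\<forall>z. shift z -` A \<inter> space P = A) \<longrightarrow> measure P A = 0 \<or> measure P A = 1)"

definition open_edges :: "('d::finite) env \<Rightarrow> (int ^ 'd) set set" where
  "open_edges \<omega> = {e \<in> lattice_edges. \<omega> e > 0}"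

definition open_adj :: "('d::finite) env \<Rightarrow> (int ^ 'd) rel" where
  "open_adj \<omega> = {(x, y). {x, y} \<in> open_edges \<omega>}"

definition C_infty :: "('d::finite) env \<Rightarrow> (int ^ 'd) set" where
  "C_infty \<omega> = {x. infinite ((open_adj \<omega>)\<^sup>* `` {x})}"

definition connected_set :: "('d::finite) env \<Rightarrow> (int ^ 'd) set \<Rightarrow> bool" where
  "connected_set \<omega> S \<longleftrightarrow> (\<forall>x\<in>S. \<forall>y\<in>S. (x, y) \<in> (open_adj \<omega> \<inter> S \<times> S)\<^sup>*)"

text \<open>The distance is \<open>\<infinity>\<close> if no path of open edges within the infinite cluster joins the points.\<close>

definition cluster_dist :: "('d::finite) env \<Rightarrow> int ^ 'd \<Rightarrow> int ^ 'd \<Rightarrow> enat" where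
  "cluster_dist \<omega> x y =
     (INF n\<in>{n. (x, y) \<in> (open_adj \<omega> \<inter> C_infty \<omega> \<times> C_infty \<omega>) ^^ n}. enat n)"

definition cluster_ball :: "('d::finite) env \<Rightarrow> int ^ 'd \<Rightarrow> real \<Rightarrow> (int ^ 'd) set" where
  "cluster_ball \<omega> x r = {y \<in> C_infty \<omega>. cluster_dist \<omega> x y \<le> enat (nat \<lfloor>r\<rfloor>)}"

definition rel_boundary ::
    "('d::finite) env \<Rightarrow> (int ^ 'd) set \<Rightarrow> (int ^ 'd) set \<Rightarrow> (int ^ 'd) set set" where
  "rel_boundary \<omega> B A = {{x, y} | x y. {x, y} \<in> open_edges \<omega> \<and> x \<in> A \<and> y \<in> B - A}"

definition regular_ball ::
    "real \<Rightarrow> real \<Rightarrow> real \<Rightarrow> ('d::finite) env \<Rightarrow> int ^ 'd \<Rightarrow> nat \<Rightarrow> bool" where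
  "regular_ball CV Criso CW \<omega> x n \<longleftrightarrow>
     CV * real n ^ CARD('d) \<le> real (card (cluster_ball \<omega> x (real n))) \<and>
     (\<exists>S. S \<subseteq> C_infty \<omega> \<and> connected_set \<omega> S \<and>
        cluster_ball \<omega> x (real n) \<subseteq> S \<and> S \<subseteq> cluster_ball \<omega> x (CW * real n) \<and>
        (\<forall>A\<subseteq>S. real (card A) \<le> 1 / 2 * real (card S) \<longrightarrow>
           real (card (rel_boundary \<omega> S A)) \<ge> Criso * (1 / real n) * real (card A)))"

text \<open>Regularity is imposed at integer radii only; for \<open>n \<ge> 1\<close> the radii \<open>r\<close> below satisfy \<open>r \<ge> 1\<close>.\<close>

definition very_regular ::
    "real \<Rightarrow> real \<Rightarrow> real \<Rightarrow> real \<Rightarrow> ('d::finite) env \<Rightarrow> nat \<Rightarrow> bool" where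
  "very_regular CV Criso CW \<theta> \<omega> n \<longleftrightarrow>
     (\<forall>x\<in>cluster_ball \<omega> 0 (real n). \<forall>r::nat.
        real r \<ge> real n powr (\<theta> / real CARD('d)) \<longrightarrow> regular_ball CV Criso CW \<omega> x r)"

definition P_zero :: "('d::finite) env measure \<Rightarrow> 'd env measure" where
  "P_zero P = uniform_measure P {\<omega> \<in> space P. 0 \<in> C_infty \<omega>}"

type_synonym 'd field = "'d env \<Rightarrow> int ^ 'd \<Rightarrow> real"

definition cocycle :: "('d::finite) env measure \<Rightarrow> 'd field \<Rightarrow> bool" where
  "cocycle P \<Psi> \<longleftrightarrow>
     (AE \<omega> in P_zero P. \<forall>x\<in>C_infty \<omega>. \<forall>y\<in>C_infty \<omega>.
        \<Psi> (shift x \<omega>) (y - x) = \<Psi> \<omega> y - \<Psi> \<omega> x)"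

definition cov_form :: "('d::finite) field \<Rightarrow> 'd field \<Rightarrow> 'd env \<Rightarrow> real" where
  "cov_form \<Psi> \<Psi>' \<omega> = (\<Sum>x | (x, 0) \<in> open_adj \<omega>. \<omega> {0, x} * (\<Psi> \<omega> x * \<Psi>' \<omega> x))"

definition cov_inner :: "('d::finite) env measure \<Rightarrow> 'd field \<Rightarrow> 'd field \<Rightarrow> real" where
  "cov_inner P \<Psi> \<Psi>' = (\<integral>\<omega>. cov_form \<Psi> \<Psi>' \<omega> \<partial>P_zero P)"

definition cov_norm :: "('d::finite) env measure \<Rightarrow> 'd field \<Rightarrow> real" where
  "cov_norm P \<Psi> = sqrt (cov_inner P \<Psi> \<Psi>)"

text \<open>
  The sets \<open>L2_cov\<close>, \<open>L2_pot\<close>, \<open>L2_sol\<close> consist of representatives; elements of the Hilbert space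
  are their classes modulo \<open>cov_eq\<close>.
\<close>

definition cov_eq :: "('d::finite) env measure \<Rightarrow> 'd field \<Rightarrow> 'd field \<Rightarrow> bool" where
  "cov_eq P \<Psi> \<Psi>' \<longleftrightarrow> (AE \<omega> in P_zero P. \<forall>x\<in>C_infty \<omega>. \<Psi> \<omega> x = \<Psi>' \<omega> x)"

definition L2_cov :: "('d::finite) env measure \<Rightarrow> 'd field set" where
  "L2_cov P = {\<Psi>.
     (\<lambda>(\<omega>, x). \<Psi> \<omega> x) \<in> borel_measurable (env_space \<Otimes>\<^sub>M count_space UNIV) \<and>
     cocycle P \<Psi> \<and>
     (\<integral>\<^sup>+\<omega>. ennreal (cov_form \<Psi> \<Psi> \<omega>) \<partial>P_zero P) < \<infinity>}"

definition bounded_local :: "(('d::finite) env \<Rightarrow> real) \<Rightarrow> bool" where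
  "bounded_local \<phi> \<longleftrightarrow>
     \<phi> \<in> borel_measurable env_space \<and>
     (\<exists>K. \<forall>\<omega>\<in>space env_space. \<bar>\<phi> \<omega>\<bar> \<le> K) \<and>
     (\<exists>F. finite F \<and> F \<subseteq> lattice_edges \<and>
        (\<forall>\<omega>\<in>space env_space. \<forall>\<omega>'\<in>space env_space. (\<forall>e\<in>F. \<omega> e = \<omega>' e) \<longrightarrow> \<phi> \<omega> = \<phi> \<omega>'))"

definition D_grad :: "(('d::finite) env \<Rightarrow> real) \<Rightarrow> 'd field" where
  "D_grad \<phi> \<omega> x = \<phi> (shift x \<omega>) - \<phi> \<omega>"

definition L2_pot :: "('d::finite) env measure \<Rightarrow> 'd field set" where
  "L2_pot P = {\<Psi> \<in> L2_cov P.
     \<forall>\<epsilon>>0. \<exists>\<phi>. bounded_local \<phi> \<and> cov_norm P (\<lambda>\<omega> x. \<Psi> \<omega> x - D_grad \<phi> \<omega> x) < \<epsilon>}"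

definition L2_sol :: "('d::finite) env measure \<Rightarrow> 'd field set" where
  "L2_sol P = {\<Phi> \<in> L2_cov P. \<forall>\<Psi>\<in>L2_pot P. cov_inner P \<Phi> \<Psi> = 0}"

definition position_field :: "'d \<Rightarrow> ('d::finite) field" where
  "position_field j \<omega> x = real_of_int (x $ j)"

text \<open>
  The corrector is determined only up to \<open>cov_eq\<close>, so it is a predicate on representatives.
\<close>

definition is_corrector :: "('d::finite) env measure \<Rightarrow> ('d \<Rightarrow> 'd field) \<Rightarrow> bool" where
  "is_corrector P chi \<longleftrightarrow>
     (\<forall>j. chi j \<in> L2_pot P \<and>
        (\<exists>\<Phi>\<in>L2_sol P. cov_eq P (position_field j) (\<lambda>\<omega> x. chi j \<omega> x + \<Phi> \<omega> x)))"

end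

theory Submission imports Defs begin

text \<open>
  Subtract from \<open>\<chi>\<^sub>j\<close> a gradient \<open>D\<phi>\<close> of a bounded local function such that the rest
  \<open>\<Psi>\<close> has small norm; \<open>D\<phi>\<close> is bounded and disappears after division by \<open>n\<close>. The isoperimetric
  inequality on the regular ball of radius \<open>n\<close> gives an \<open>l\<^sup>1\<close> Poincare inequality, which bounds the
  oscillation of \<open>\<Psi>\<close> around a median by \<open>n\<close> times the sum over a box of translates of
  \<open>g = \<Sum>\<^bsub>z \<sim> 0\<^esub> \<bar>\<Psi>(\<cdot>, z)\<bar>\<close>. The lower moment condition makes \<open>E g\<close> small, and a weak type (1,1)
  maximal inequality makes the box averages of \<open>g\<close> small at all scales simultaneously, with
  probability close to one. Comparing the medians at successive dyadic scales shows that they grow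
  at most linearly with small slope. Since the limit superior does not depend on \<open>\<phi>\<close>, the
  maximal inequality can take the place of the pointwise ergodic theorem.
\<close>

section \<open>Isoperimetry and the l^1 Poincare inequality on a finite graph\<close>

text \<open>A discrete coarea argument. Lowering \<open>f\<close> on its support by its least
  positive value \<open>t\<close> removes \<open>t\<close> times the size of the support from the
  sum of \<open>f\<close>, and at least \<open>t\<close> for each pair of \<open>R\<close> leaving
  the support from the gradient sum; isoperimetry compares the two amounts. The induction is on the
  size of the support, which never exceeds half of \<open>S\<close>.\<close>

lemma isoperimetry_imp_gradient_bound:
  fixes f :: "'a \<Rightarrow> real"
  assumes fin: "finite S" "R \<subseteq> S \<times> S"
    and iso: "\<And>A. A \<subseteq> S \<Longrightarrow> 2 * card A \<le> card S \<Longrightarrow>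
      c * real (card A) \<le> real (card {(x, y) \<in> R. x \<in> A \<and> y \<notin> A})"
    and nonneg: "\<And>x. x \<in> S \<Longrightarrow> 0 \<le> f x"
    and small: "2 * card {x \<in> S. 0 < f x} \<le> card S"
  shows "c * (\<Sum>x\<in>S. f x) \<le> (\<Sum>(x, y)\<in>R. \<bar>f x - f y\<bar>)"
  using nonneg small
proof (induction "card {x \<in> S. 0 < f x}" arbitrary: f rule: less_induct)
  case less
  have finR: "finite R" using fin finite_subset by blast
  define A where "A = {x \<in> S. 0 < f x}"
  have finA: "finite A" and AS: "A \<subseteq> S" using fin by (auto simp: A_def)
  have zero: "f x = 0" if "x \<in> S - A" for x
    using that less.prems(1)[of x] by (auto simp: A_def)
  show ?case
  proof (cases "A = {}")
    case True
    then have "(\<Sum>x\<in>S. f x) = 0" using zero by simp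
    then show ?thesis by (simp add: sum_nonneg case_prod_beta)
  next
    case False
    define t where "t = Min (f ` A)"
    have t_in: "t \<in> f ` A" unfolding t_def using finA False by (intro Min_in) auto
    then obtain a where a: "a \<in> A" "f a = t" by auto
    have t_le: "t \<le> f x" if "x \<in> A" for x
      unfolding t_def using finA that by (intro Min_le) auto
    have tpos: "0 < t" using a by (auto simp: A_def)
    define f' where "f' x = (if x \<in> A then f x - t else f x)" for x
    have f'_nonneg: "0 \<le> f' x" if "x \<in> S" for x
      using that t_le less.prems(1) by (auto simp: f'_def)
    \<comment> \<open>The minimisers drop out of the support, so the induction hypothesis applies to
      \<open>f'\<close>.\<close>
    have psub: "{x \<in> S. 0 < f' x} \<subset> A"
    proof
      show "{x \<in> S. 0 < f' x} \<subseteq> A" by (auto simp: f'_def A_def)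
      have "a \<notin> {x \<in> S. 0 < f' x}" using a by (auto simp: f'_def)
      then show "{x \<in> S. 0 < f' x} \<noteq> A" using a by auto
    qed
    then have less_card: "card {x \<in> S. 0 < f' x} < card A"
      using finA by (intro psubset_card_mono)
    have IH: "c * (\<Sum>x\<in>S. f' x) \<le> (\<Sum>(x, y)\<in>R. \<bar>f' x - f' y\<bar>)"
      using less.hyps[of f'] less_card f'_nonneg less.prems(2) by (auto simp: A_def)
    have "(\<Sum>x\<in>S. f x) = (\<Sum>x\<in>S. f' x + (if x \<in> A then t else 0))"
      by (intro sum.cong) (auto simp: f'_def)
    also have "\<dots> = (\<Sum>x\<in>S. f' x) + t * real (card A)"
      using fin AS by (simp add: sum.distrib sum.If_cases Int_absorb1)
    finally have sum_f: "(\<Sum>x\<in>S. f x) = (\<Sum>x\<in>S. f' x) + t * real (card A)" .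
    have "(\<Sum>(x, y)\<in>R. \<bar>f' x - f' y\<bar> + (if x \<in> A \<and> y \<notin> A then t else 0))
        \<le> (\<Sum>(x, y)\<in>R. \<bar>f x - f y\<bar>)"
    proof (intro sum_mono, clarify)
      fix x y assume "(x, y) \<in> R"
      then have "x \<in> S" "y \<in> S" using fin by auto
      then show "\<bar>f' x - f' y\<bar> + (if x \<in> A \<and> y \<notin> A then t else 0) \<le> \<bar>f x - f y\<bar>"
        using zero[of x] zero[of y] t_le[of x] t_le[of y] tpos by (auto simp: f'_def)
    qed
    moreover have "(\<Sum>(x, y)\<in>R. (if x \<in> A \<and> y \<notin> A then t else 0))
        = t * real (card {(x, y) \<in> R. x \<in> A \<and> y \<notin> A})"
    proof -
      have "{(x, y) \<in> R. x \<in> A \<and> y \<notin> A} = R \<inter> {p. fst p \<in> A \<and> snd p \<notin> A}" by auto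
      then show ?thesis using finR by (simp add: case_prod_beta sum.If_cases)
    qed
    moreover have "t * (c * real (card A)) \<le> t * real (card {(x, y) \<in> R. x \<in> A \<and> y \<notin> A})"
      using iso[OF AS] less.prems(2) tpos by (intro mult_left_mono) (auto simp: A_def)
    ultimately show ?thesis
      using IH by (simp add: sum_f case_prod_beta sum.distrib algebra_simps)
  qed
qed

text \<open>Take the least value of \<open>u\<close> with at most half of the points strictly above
  it. If more than half lay strictly below it, the next smaller value would qualify as well.\<close>

lemma finite_median_exists:
  fixes u :: "'a \<Rightarrow> real"
  assumes "finite S"
  obtains m where "2 * card {x \<in> S. m < u x} \<le> card S" "2 * card {x \<in> S. u x < m} \<le> card S"
proof (cases "S = {}")
  case False
  define V where "V = {v \<in> u ` S. 2 * card {x \<in> S. v < u x} \<le> card S}"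
  have finV: "finite V" using assms by (simp add: V_def)
  have "{x \<in> S. Max (u ` S) < u x} = {}" using assms by (auto simp: not_less)
  then have "card {x \<in> S. Max (u ` S) < u x} = 0" by (simp only: card.empty)
  moreover have "Max (u ` S) \<in> u ` S" using assms False by (intro Max_in) auto
  ultimately have "Max (u ` S) \<in> V" by (simp add: V_def)
  then have m: "Min V \<in> V" using finV by (intro Min_in) auto
  have "2 * card {x \<in> S. u x < Min V} \<le> card S"
  proof (rule ccontr)
    assume neg: "\<not> ?thesis"
    let ?L = "{x \<in> S. u x < Min V}"
    have finL: "finite ?L" using assms by simp
    have Lne: "?L \<noteq> {}" using neg by (metis card.empty le0 mult_0_right)
    define v where "v = Max (u ` ?L)"
    have "v \<in> u ` ?L" unfolding v_def using finL Lne by (intro Max_in) auto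
    then have v: "v \<in> u ` S" "v < Min V" by auto
    have "{x \<in> S. v < u x} \<subseteq> S - ?L"
    proof clarify
      fix x assume "x \<in> S" "v < u x" "u x < Min V"
      then have "u x \<le> v" unfolding v_def using finL by (intro Max_ge) auto
      with \<open>v < u x\<close> show False by simp
    qed
    then have "card {x \<in> S. v < u x} \<le> card (S - ?L)" using assms by (intro card_mono) auto
    also have "\<dots> = card S - card ?L" using finL by (intro card_Diff_subset) auto
    finally have "2 * card {x \<in> S. v < u x} \<le> card S" using neg by simp
    then have "v \<in> V" using v by (simp add: V_def)
    then show False using v(2) Min_le[OF finV] by fastforce
  qed
  then show ?thesis using that m by (auto simp: V_def)
qed (use that in auto)

text \<open>For a median \<open>m\<close> the positive parts of \<open>u - m\<close> and
  \<open>m - u\<close> are each supported on at most half of \<open>S\<close>, so the gradient bound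
  applies to both. Truncation does not increase differences; bounding each part by the full gradient
  sum gives the factor 2.\<close>

lemma isoperimetry_imp_poincare:
  fixes u :: "'a \<Rightarrow> real"
  assumes fin: "finite S" "R \<subseteq> S \<times> S"
    and iso: "\<And>A. A \<subseteq> S \<Longrightarrow> 2 * card A \<le> card S \<Longrightarrow>
      c * real (card A) \<le> real (card {(x, y) \<in> R. x \<in> A \<and> y \<notin> A})"
  shows "\<exists>m. c * (\<Sum>x\<in>S. \<bar>u x - m\<bar>) \<le> 2 * (\<Sum>(x, y)\<in>R. \<bar>u x - u y\<bar>)"
proof -
  obtain m where m: "2 * card {x \<in> S. m < u x} \<le> card S" "2 * card {x \<in> S. u x < m} \<le> card S"
    using finite_median_exists[OF fin(1)] by metis
  have pos: "c * (\<Sum>x\<in>S. max 0 (u x - m)) \<le> (\<Sum>(x, y)\<in>R. \<bar>max 0 (u x - m) - max 0 (u y - m)\<bar>)"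
    using m(1) by (intro isoperimetry_imp_gradient_bound[OF fin iso]) (auto simp: less_max_iff_disj)
  have neg: "c * (\<Sum>x\<in>S. max 0 (m - u x)) \<le> (\<Sum>(x, y)\<in>R. \<bar>max 0 (m - u x) - max 0 (m - u y)\<bar>)"
    using m(2) by (intro isoperimetry_imp_gradient_bound[OF fin iso]) (auto simp: less_max_iff_disj)
  have "(\<Sum>(x, y)\<in>R. \<bar>max 0 (u x - m) - max 0 (u y - m)\<bar>)
      + (\<Sum>(x, y)\<in>R. \<bar>max 0 (m - u x) - max 0 (m - u y)\<bar>)
      \<le> (\<Sum>(x, y)\<in>R. \<bar>u x - u y\<bar>) + (\<Sum>(x, y)\<in>R. \<bar>u x - u y\<bar>)"
    by (intro add_mono sum_mono) (auto simp: max_def)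
  moreover have "(\<Sum>x\<in>S. \<bar>u x - m\<bar>) = (\<Sum>x\<in>S. max 0 (u x - m)) + (\<Sum>x\<in>S. max 0 (m - u x))"
    by (simp add: sum.distrib[symmetric]) (intro sum.cong, auto)
  ultimately have "c * (\<Sum>x\<in>S. \<bar>u x - m\<bar>) \<le> 2 * (\<Sum>(x, y)\<in>R. \<bar>u x - u y\<bar>)"
    using pos neg by (simp add: distrib_left)
  then show ?thesis ..
qed

section \<open>Cubes and a covering argument\<close>

definition cube :: "nat \<Rightarrow> (int ^ 'd::finite) set" where
  "cube n = {x. \<forall>i. \<bar>x $ i\<bar> \<le> int n}"

lemma cube_mono: "m \<le> n \<Longrightarrow> cube m \<subseteq> cube n"
  unfolding cube_def by (auto intro: order_trans)

lemma finite_card_cube: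
  "finite (cube n :: (int ^ 'd::finite) set) \<and>
   card (cube n :: (int ^ 'd::finite) set) = (2 * n + 1) ^ CARD('d)"
proof -
  have "bij_betw vec_nth (cube n :: (int ^ 'd) set) (\<Pi>\<^sub>E i\<in>UNIV. {- int n..int n})"
  proof (rule bij_betwI[where g = vec_lambda])
    show "vec_nth \<in> (cube n :: (int ^ 'd) set) \<rightarrow> (\<Pi>\<^sub>E i\<in>UNIV. {- int n..int n})"
      by (force simp: cube_def abs_le_iff)
    show "vec_lambda \<in> (\<Pi>\<^sub>E i\<in>UNIV. {- int n..int n}) \<rightarrow> (cube n :: (int ^ 'd) set)"
      by (auto simp: cube_def PiE_def Pi_def abs_le_iff neg_le_iff_le minus_le_iff)
  qed auto
  from bij_betw_finite[OF this] bij_betw_same_card[OF this] show ?thesis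
    by (simp add: card_PiE finite_PiE nat_add_distrib nat_mult_distrib)
qed

lemmas finite_cube = finite_card_cube[THEN conjunct1]
lemmas card_cube = finite_card_cube[THEN conjunct2]

lemma card_translate: "card ((+) (x :: 'a::group_add) ` A) = card A"
  by (simp add: card_image)

text \<open>Greedy Vitali selection: choose a point of largest radius. All points whose cubes meet
  its cube lie within twice that radius, so their number is paid for by the mass of the chosen cube.
  The other points are handled by induction.\<close>

lemma vitali_counting:
  fixes h :: "int ^ 'd::finite \<Rightarrow> real"
  assumes fin: "finite E" and h: "\<And>y. 0 \<le> h y" and lam: "0 \<le> \<kappa>"
    and r: "\<And>x. x \<in> E \<Longrightarrow> 1 \<le> r x"
    and big: "\<And>x. x \<in> E \<Longrightarrow> \<kappa> * real (r x) ^ CARD('d) \<le> (\<Sum>y\<in>(+) x ` cube (r x). h y)"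
  shows "\<kappa> * real (card E) \<le> 5 ^ CARD('d) * (\<Sum>y\<in>(\<Union>x\<in>E. (+) x ` cube (r x)). h y)"
  using fin r big
proof (induction "card E" arbitrary: E rule: less_induct)
  case less
  define B where "B x = (+) x ` (cube (r x) :: (int ^ 'd) set)" for x
  have finB: "finite (B x)" for x by (simp add: B_def finite_cube)
  show ?case
  proof (cases "E = {}")
    case False
    then have "Max (r ` E) \<in> r ` E" using less.prems by (intro Max_in) auto
    then obtain x where x: "x \<in> E" "r x = Max (r ` E)" by auto
    have r_le: "r y \<le> r x" if "y \<in> E" for y
      using less.prems(1) that by (simp add: x(2))
    \<comment> \<open>The cubes of \<open>E'\<close> avoid \<open>B x\<close>, so the mass used for
      \<open>E'\<close> and the mass of \<open>B x\<close> are never counted twice.\<close>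
    define E' where "E' = {y \<in> E. B y \<inter> B x = {}}"
    have "0 \<in> (cube (r x) :: (int ^ 'd) set)" by (simp add: cube_def)
    then have "x \<in> B x" unfolding B_def by force
    then have "E' \<subset> E" using x by (auto simp: E'_def)
    then have "card E' < card E" using less.prems(1) by (intro psubset_card_mono)
    then have IH: "\<kappa> * real (card E') \<le> 5 ^ CARD('d) * (\<Sum>y\<in>(\<Union>x\<in>E'. B x). h y)"
      unfolding B_def using less.prems by (intro less.hyps) (auto simp: E'_def)
    have "E - E' \<subseteq> (+) x ` cube (2 * r x)"
    proof
      fix y assume "y \<in> E - E'"
      then obtain a b where ab: "a \<in> cube (r y)" "b \<in> cube (r x)" "y + a = x + b" and "y \<in> E"
        by (auto simp: E'_def B_def)
      have "y - x = b - a" using ab(3) by (simp add: algebra_simps)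
      moreover have "b - a \<in> cube (2 * r x)" unfolding cube_def
      proof clarify
        fix i
        have "\<bar>a $ i\<bar> \<le> int (r y)" "\<bar>b $ i\<bar> \<le> int (r x)" using ab by (auto simp: cube_def)
        then show "\<bar>(b - a) $ i\<bar> \<le> int (2 * r x)" using r_le[OF \<open>y \<in> E\<close>] by simp
      qed
      ultimately have "y - x \<in> cube (2 * r x)" by simp
      then have "x + (y - x) \<in> (+) x ` cube (2 * r x)" by (rule imageI)
      then show "y \<in> (+) x ` cube (2 * r x)" by simp
    qed
    then have "card (E - E') \<le> card ((+) x ` (cube (2 * r x) :: (int ^ 'd) set))"
      by (intro card_mono) (auto simp: finite_cube)
    also have "\<dots> = (4 * r x + 1) ^ CARD('d)" by (simp add: card_translate card_cube)
    \<comment> \<open>The radius is at least 1 and absorbs the summand 1; this is the origin of the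
      constant 5.\<close>
    also have "\<dots> \<le> (5 * r x) ^ CARD('d)" using less.prems(2)[OF x(1)] by (intro power_mono) auto
    finally have "real (card (E - E')) \<le> real ((5 * r x) ^ CARD('d))" by (simp only: of_nat_le_iff)
    then have "real (card (E - E')) \<le> 5 ^ CARD('d) * real (r x) ^ CARD('d)"
      by (simp add: power_mult_distrib)
    then have "\<kappa> * real (card (E - E')) \<le> \<kappa> * (5 ^ CARD('d) * real (r x) ^ CARD('d))"
      using lam by (rule mult_left_mono)
    also have "\<dots> \<le> 5 ^ CARD('d) * (\<Sum>y\<in>B x. h y)"
      using less.prems(3)[OF x(1)] by (simp add: B_def)
    finally have near: "\<kappa> * real (card (E - E')) \<le> 5 ^ CARD('d) * (\<Sum>y\<in>B x. h y)" .
    have "card E' \<le> card E" using \<open>card E' < card E\<close> by simp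
    moreover have "card (E - E') = card E - card E'"
      using \<open>E' \<subset> E\<close> less.prems(1) by (intro card_Diff_subset) (auto intro: finite_subset)
    ultimately have "card E = card E' + card (E - E')" by simp
    then have "\<kappa> * real (card E) \<le> 5 ^ CARD('d) * ((\<Sum>y\<in>(\<Union>x\<in>E'. B x). h y) + (\<Sum>y\<in>B x. h y))"
      using near IH by (simp add: distrib_left)
    also have "(\<Sum>y\<in>(\<Union>x\<in>E'. B x). h y) + (\<Sum>y\<in>B x. h y) = (\<Sum>y\<in>(\<Union>x\<in>E'. B x) \<union> B x. h y)"
      using less.prems(1) finB by (intro sum.union_disjoint[symmetric]) (auto simp: E'_def)
    also have "5 ^ CARD('d) * \<dots> \<le> 5 ^ CARD('d) * (\<Sum>y\<in>(\<Union>x\<in>E. B x). h y)"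
      using less.prems(1) finB h x \<open>E' \<subset> E\<close> by (intro mult_left_mono sum_mono2) auto
    finally show ?thesis by (simp add: B_def)
  qed simp
qed

section \<open>Shifts, open edges and balls in the infinite cluster\<close>

lemma edge_iff: "{x, y} \<in> lattice_edges \<longleftrightarrow> (\<Sum>i\<in>UNIV. \<bar>x $ i - y $ i\<bar>) = 1"
  unfolding lattice_edges_def by (auto simp: doubleton_eq_iff abs_minus_commute)

lemma edge_translate_iff: "{x + z, y + z} \<in> lattice_edges \<longleftrightarrow> {x, y} \<in> lattice_edges"
  by (simp add: edge_iff)

lemma translate_edge: "e \<in> lattice_edges \<Longrightarrow> (\<lambda>x. x + z) ` e \<in> lattice_edges"
  unfolding lattice_edges_def by (fastforce simp: doubleton_eq_iff)

lemma shift_shift: "shift y (shift x \<omega>) = shift (x + y) \<omega>"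
  unfolding shift_def by (rule restrict_ext) (auto simp: translate_edge image_image add_ac)

lemma measurable_shift: "shift z \<in> env_space \<rightarrow>\<^sub>M env_space"
  unfolding env_space_def shift_def
  by (intro measurable_restrict measurable_component_singleton translate_edge)

lemma shift_in_space: "\<omega> \<in> space env_space \<Longrightarrow> shift z \<omega> \<in> space env_space"
  by (rule measurable_space[OF measurable_shift])

lemma env_nonneg: "\<omega> \<in> space env_space \<Longrightarrow> e \<in> lattice_edges \<Longrightarrow> 0 \<le> \<omega> e"
  by (auto simp: env_space_def space_PiM space_restrict_space PiE_def Pi_def)

lemma shift_edge: "{a, b} \<in> lattice_edges \<Longrightarrow> shift z \<omega> {a, b} = \<omega> {a + z, b + z}"
  by (simp add: shift_def)

lemma open_adj_iff: "(x, y) \<in> open_adj \<omega> \<longleftrightarrow> {x, y} \<in> lattice_edges \<and> 0 < \<omega> {x, y}"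
  by (simp add: open_adj_def open_edges_def)

lemma open_adj_sym: "(x, y) \<in> open_adj \<omega> \<longleftrightarrow> (y, x) \<in> open_adj \<omega>"
  by (simp add: open_adj_iff insert_commute)

lemma open_adj_shift: "(a, b) \<in> open_adj (shift z \<omega>) \<longleftrightarrow> (a + z, b + z) \<in> open_adj \<omega>"
  by (auto simp: open_adj_iff shift_edge edge_translate_iff)

lemma open_connected_shift:
  "(a, b) \<in> (open_adj (shift z \<omega>))\<^sup>* \<longleftrightarrow> (a + z, b + z) \<in> (open_adj \<omega>)\<^sup>*"
proof
  show "(a, b) \<in> (open_adj (shift z \<omega>))\<^sup>* \<Longrightarrow> (a + z, b + z) \<in> (open_adj \<omega>)\<^sup>*"
    by (induction rule: rtrancl_induct) (auto simp: open_adj_shift intro: rtrancl_into_rtrancl)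
  have "(p, q) \<in> (open_adj \<omega>)\<^sup>* \<Longrightarrow> (p - z, q - z) \<in> (open_adj (shift z \<omega>))\<^sup>*" for p q
    by (induction rule: rtrancl_induct) (auto simp: open_adj_shift intro: rtrancl_into_rtrancl)
  from this[of "a + z" "b + z"]
  show "(a + z, b + z) \<in> (open_adj \<omega>)\<^sup>* \<Longrightarrow> (a, b) \<in> (open_adj (shift z \<omega>))\<^sup>*" by simp
qed

lemma C_infty_shift: "x \<in> C_infty (shift z \<omega>) \<longleftrightarrow> x + z \<in> C_infty \<omega>"
proof -
  have "(open_adj \<omega>)\<^sup>* `` {x + z} = (\<lambda>y. y + z) ` ((open_adj (shift z \<omega>))\<^sup>* `` {x})"
  proof safe
    fix b assume "(x + z, b) \<in> (open_adj \<omega>)\<^sup>*"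
    then have "(x, b - z) \<in> (open_adj (shift z \<omega>))\<^sup>*" by (simp add: open_connected_shift)
    then show "b \<in> (\<lambda>y. y + z) ` ((open_adj (shift z \<omega>))\<^sup>* `` {x})"
      by (intro image_eqI[where x = "b - z"]) auto
  qed (simp add: open_connected_shift)
  moreover have "inj (\<lambda>y. y + z)" by (simp add: inj_def)
  ultimately show ?thesis unfolding C_infty_def by (simp add: finite_image_iff inj_on_subset)
qed

text \<open>Despite the name, the origin is not a member: this is the unit sphere of the l^1 norm.
  It serves as a fixed finite index set for sums over open neighbours, whose own index set varies
  with the environment.\<close>

definition unit_ball :: "(int ^ 'd::finite) set" where
  "unit_ball = {z. {0, z} \<in> lattice_edges}"

lemma finite_unit_ball: "finite unit_ball"
proof (rule finite_subset[OF _ finite_cube[of 1]])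
  show "unit_ball \<subseteq> cube 1"
  proof
    fix z :: "int ^ 'd" assume "z \<in> unit_ball"
    then have "(\<Sum>i\<in>UNIV. \<bar>z $ i\<bar>) = 1" by (simp add: unit_ball_def edge_iff)
    moreover have "\<bar>z $ i\<bar> \<le> (\<Sum>i\<in>UNIV. \<bar>z $ i\<bar>)" for i by (intro member_le_sum) auto
    ultimately show "z \<in> cube 1" by (simp add: cube_def)
  qed
qed

lemma open_adj_0_eq: "{z. (z, 0) \<in> open_adj \<omega>} = {z \<in> unit_ball. 0 < \<omega> {0, z}}"
  by (auto simp: open_adj_iff unit_ball_def insert_commute)

lemma open_adj_cube:
  assumes "(x, y) \<in> open_adj \<omega>" "x \<in> cube n"
  shows "y \<in> cube (Suc n)"
  unfolding cube_def
proof clarify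
  fix i
  have "(\<Sum>i\<in>UNIV. \<bar>x $ i - y $ i\<bar>) = 1" using assms by (simp add: open_adj_iff edge_iff)
  moreover have "\<bar>x $ i - y $ i\<bar> \<le> (\<Sum>i\<in>UNIV. \<bar>x $ i - y $ i\<bar>)" by (intro member_le_sum) auto
  moreover have "\<bar>x $ i\<bar> \<le> int n" using assms by (simp add: cube_def)
  ultimately show "\<bar>y $ i\<bar> \<le> int (Suc n)" by linarith
qed

text \<open>A finite graph distance is realised by a path, and each step of a path changes every
  coordinate by at most one. In particular balls around the origin are finite.\<close>

lemma cluster_ball_subset_cube:
  assumes "r \<le> real n"
  shows "cluster_ball \<omega> 0 r \<subseteq> cube n"
proof
  fix y assume "y \<in> cluster_ball \<omega> 0 r"
  then have "cluster_dist \<omega> 0 y \<le> enat (nat \<lfloor>r\<rfloor>)" by (simp add: cluster_ball_def)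
  moreover have "nat \<lfloor>r\<rfloor> \<le> n" using assms by linarith
  ultimately have le: "cluster_dist \<omega> 0 y \<le> enat n" by (metis enat_ord_simps(1) order_trans)
  let ?T = "{k. (0, y) \<in> (open_adj \<omega> \<inter> C_infty \<omega> \<times> C_infty \<omega>) ^^ k}"
  \<comment> \<open>Without a path the infimum runs over the empty set and is infinite; over a
    nonempty set it is attained, since \<open>enat\<close> is well-ordered.\<close>
  have "?T \<noteq> {}"
  proof
    assume "?T = {}"
    then have "cluster_dist \<omega> 0 y = \<infinity>" unfolding cluster_dist_def by (simp add: top_enat_def)
    then show False using le by simp
  qed
  then have "cluster_dist \<omega> 0 y \<in> enat ` ?T"
    unfolding cluster_dist_def by (auto intro: wellorder_InfI)
  then obtain k where k: "k \<in> ?T" "k \<le> n" using le by auto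
  have "(0, y) \<in> (open_adj \<omega> \<inter> C_infty \<omega> \<times> C_infty \<omega>) ^^ k \<Longrightarrow> y \<in> cube k" for y k
    by (induction k arbitrary: y) (auto simp: cube_def[of 0] elim!: relcompE intro: open_adj_cube)
  then show "y \<in> cube n" using k cube_mono[OF k(2)] by blast
qed

lemma finite_cluster_ball: "finite (cluster_ball \<omega> 0 (real n))"
  using cluster_ball_subset_cube[of "real n" n] finite_cube by (auto intro: finite_subset)

lemma cluster_ball_mono: "m \<le> n \<Longrightarrow> cluster_ball \<omega> x (real m) \<subseteq> cluster_ball \<omega> x (real n)"
  by (auto simp: cluster_ball_def elim: order_trans)

lemma zero_in_cluster_ball:
  assumes "0 \<in> C_infty \<omega>" shows "0 \<in> cluster_ball \<omega> 0 (real n)"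
proof -
  have "cluster_dist \<omega> 0 0 \<le> enat 0" unfolding cluster_dist_def by (rule INF_lower) simp
  then show ?thesis using assms by (simp add: cluster_ball_def enat_0)
qed

section \<open>Oscillation on regular balls and growth of the medians\<close>

text \<open>The finite Poincare inequality is applied to the isoperimetric set \<open>S\<close> with
  constant \<open>Criso / n\<close>. As \<open>S\<close> lies between the ball and a cube, the left
  side may be restricted to the ball and the right side enlarged to the cube. The natural number
  \<open>W\<close> replaces \<open>CW\<close> to make the radius of the cube a natural
  number.\<close>

lemma regular_ball_poincare:
  fixes u G :: "int ^ 'd::finite \<Rightarrow> real"
  assumes reg: "regular_ball CV Criso CW \<omega> 0 n" and n: "1 \<le> n"
    and const: "0 < Criso" "CW \<le> real W"
    and G: "\<And>x. 0 \<le> G x"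
    and grad: "\<And>x. x \<in> C_infty \<omega> \<Longrightarrow>
      (\<Sum>y | (y, x) \<in> open_adj \<omega> \<and> y \<in> C_infty \<omega>. \<bar>u x - u y\<bar>) \<le> G x"
  shows "\<exists>m. (\<Sum>x\<in>cluster_ball \<omega> 0 (real n). \<bar>u x - m\<bar>)
    \<le> 2 * real n / Criso * (\<Sum>x\<in>cube (W * n). G x)"
proof -
  obtain S where S: "S \<subseteq> C_infty \<omega>" "cluster_ball \<omega> 0 (real n) \<subseteq> S"
      "S \<subseteq> cluster_ball \<omega> 0 (CW * real n)"
    and iso: "\<And>A. A \<subseteq> S \<Longrightarrow> real (card A) \<le> 1 / 2 * real (card S) \<Longrightarrow>
           real (card (rel_boundary \<omega> S A)) \<ge> Criso * (1 / real n) * real (card A)"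
    using reg unfolding regular_ball_def by blast
  have "CW * real n \<le> real (W * n)" using const by (simp add: mult_right_mono)
  then have Scube: "S \<subseteq> cube (W * n)" using S(3) cluster_ball_subset_cube by blast
  then have finS: "finite S" using finite_cube finite_subset by blast
  define R where "R = {(x, y) \<in> S \<times> S. (x, y) \<in> open_adj \<omega>}"
  have finR: "finite R" unfolding R_def using finS by (auto intro: finite_subset[of _ "S \<times> S"])
  have "\<exists>m. Criso * (1 / real n) * (\<Sum>x\<in>S. \<bar>u x - m\<bar>) \<le> 2 * (\<Sum>(x, y)\<in>R. \<bar>u x - u y\<bar>)"
  proof (rule isoperimetry_imp_poincare[OF finS])
    fix A assume A: "A \<subseteq> S" "2 * card A \<le> card S"
    \<comment> \<open>\<open>rel_boundary\<close> consists of unordered edges, \<open>R\<close> of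
      ordered pairs; every boundary edge is the image of a pair leaving \<open>A\<close>.\<close>
    have "rel_boundary \<omega> S A \<subseteq> (\<lambda>(x, y). {x, y}) ` {(x, y) \<in> R. x \<in> A \<and> y \<notin> A}"
    proof
      fix e assume "e \<in> rel_boundary \<omega> S A"
      then obtain x y where "e = {x, y}" "{x, y} \<in> open_edges \<omega>" "x \<in> A" "y \<in> S - A"
        unfolding rel_boundary_def by blast
      then show "e \<in> (\<lambda>(x, y). {x, y}) ` {(x, y) \<in> R. x \<in> A \<and> y \<notin> A}"
        using A by (intro image_eqI[where x = "(x, y)"]) (auto simp: R_def open_adj_def)
    qed
    then have "card (rel_boundary \<omega> S A) \<le> card {(x, y) \<in> R. x \<in> A \<and> y \<notin> A}"
      using finR by (intro surj_card_le) (auto intro: finite_subset[of _ R])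
    moreover have "real (card A) \<le> 1 / 2 * real (card S)" using A(2) by linarith
    ultimately show "Criso * (1 / real n) * real (card A)
        \<le> real (card {(x, y) \<in> R. x \<in> A \<and> y \<notin> A})"
      using iso[OF A(1)] by linarith
  qed (auto simp: R_def)
  then obtain m where m: "Criso * (1 / real n) * (\<Sum>x\<in>S. \<bar>u x - m\<bar>) \<le> 2 * (\<Sum>(x, y)\<in>R. \<bar>u x - u y\<bar>)"
    ..
  \<comment> \<open>Grouping the pairs by their first endpoint produces the local sums controlled by
    \<open>G\<close>.\<close>
  have "R = Sigma S (\<lambda>x. {y \<in> S. (x, y) \<in> open_adj \<omega>})" by (auto simp: R_def)
  then have "(\<Sum>(x, y)\<in>R. \<bar>u x - u y\<bar>) = (\<Sum>x\<in>S. \<Sum>y | y \<in> S \<and> (x, y) \<in> open_adj \<omega>. \<bar>u x - u y\<bar>)"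
    using finS by (simp add: sum.Sigma)
  also have "\<dots> \<le> (\<Sum>x\<in>S. G x)"
  proof (intro sum_mono)
    fix x assume x: "x \<in> S"
    have fin: "finite {y. (y, x) \<in> open_adj \<omega> \<and> y \<in> C_infty \<omega>}"
    proof (rule finite_subset)
      show "{y. (y, x) \<in> open_adj \<omega> \<and> y \<in> C_infty \<omega>} \<subseteq> cube (Suc (W * n))"
        using open_adj_cube[of x _ \<omega> "W * n"] Scube x open_adj_sym[of x _ \<omega>] by blast
    qed (rule finite_cube)
    have "(\<Sum>y | y \<in> S \<and> (x, y) \<in> open_adj \<omega>. \<bar>u x - u y\<bar>)
        \<le> (\<Sum>y | (y, x) \<in> open_adj \<omega> \<and> y \<in> C_infty \<omega>. \<bar>u x - u y\<bar>)"
      using S(1) open_adj_sym[of x _ \<omega>] by (intro sum_mono2[OF fin]) auto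
    also have "\<dots> \<le> G x" using grad x S(1) by blast
    finally show "(\<Sum>y | y \<in> S \<and> (x, y) \<in> open_adj \<omega>. \<bar>u x - u y\<bar>) \<le> G x" .
  qed
  also have "\<dots> \<le> (\<Sum>x\<in>cube (W * n). G x)" by (intro sum_mono2 finite_cube Scube G)
  finally have "Criso * (1 / real n) * (\<Sum>x\<in>S. \<bar>u x - m\<bar>) \<le> 2 * (\<Sum>x\<in>cube (W * n). G x)"
    using m by linarith
  then have "(\<Sum>x\<in>S. \<bar>u x - m\<bar>) \<le> 2 * real n / Criso * (\<Sum>x\<in>cube (W * n). G x)"
    using const n by (simp add: field_simps)
  moreover have "(\<Sum>x\<in>cluster_ball \<omega> 0 (real n). \<bar>u x - m\<bar>) \<le> (\<Sum>x\<in>S. \<bar>u x - m\<bar>)"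
    using S(2) by (intro sum_mono2 finS) auto
  ultimately show ?thesis by (meson order_trans)
qed

text \<open>Oscillation of order \<open>c * n ^ (d + 1)\<close> on a set of at least
  \<open>CV * n ^ d\<close> points forces the centring constants of comparable scales to differ by a
  multiple of \<open>c / CV * n\<close>. Halving the scale repeatedly sums these differences
  geometrically. Only \<open>A\<close>, not the slope, depends on the small scales.\<close>

lemma linear_growth_of_means:
  fixes u :: "'a \<Rightarrow> real" and B :: "nat \<Rightarrow> 'a set"
  assumes fin: "\<And>n. finite (B n)" and mono: "\<And>m n. m \<le> n \<Longrightarrow> B m \<subseteq> B n"
    and N: "1 \<le> N" and CV: "0 < CV" and c: "0 \<le> c"
    and vol: "\<And>n. N \<le> n \<Longrightarrow> CV * real n ^ d \<le> real (card (B n))"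
    and osc: "\<And>n. N \<le> n \<Longrightarrow> \<exists>m. (\<Sum>x\<in>B n. \<bar>u x - m\<bar>) \<le> c * real n ^ Suc d"
  shows "\<exists>A. \<forall>n\<ge>N. (\<Sum>x\<in>B n. \<bar>u x\<bar>)
    \<le> real (card (B n)) * (A + (3 + 2 * 2 ^ Suc d) * c / CV * real n)"
proof -
  obtain m where m: "(\<Sum>x\<in>B n. \<bar>u x - m n\<bar>) \<le> c * real n ^ Suc d" if "N \<le> n" for n
    using osc by metis
  \<comment> \<open>The 1 comes from the oscillation at scale \<open>n\<close>, the power of 2 from
    the one at scale \<open>n'\<close>, which is at most \<open>2 * n\<close>.\<close>
  define b where "b = c * (1 + 2 ^ Suc d) / CV"
  have b: "0 \<le> b" using c CV by (simp add: b_def)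
  have step: "\<bar>m n - m n'\<bar> \<le> b * real n" if n: "N \<le> n" "n \<le> n'" "n' \<le> 2 * n" for n n'
  proof -
    have "real (card (B n)) * \<bar>m n - m n'\<bar> = (\<Sum>x\<in>B n. \<bar>m n - m n'\<bar>)" by simp
    also have "\<dots> \<le> (\<Sum>x\<in>B n. \<bar>u x - m n\<bar> + \<bar>u x - m n'\<bar>)" by (intro sum_mono) linarith
    also have "\<dots> \<le> (\<Sum>x\<in>B n. \<bar>u x - m n\<bar>) + (\<Sum>x\<in>B n'. \<bar>u x - m n'\<bar>)"
      unfolding sum.distrib using n fin mono by (intro add_mono sum_mono2) auto
    also have "\<dots> \<le> c * real n ^ Suc d + c * real n' ^ Suc d"
      using n by (intro add_mono m) auto
    also have "\<dots> \<le> c * real n ^ Suc d + c * (2 * real n) ^ Suc d"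
      using n c by (intro add_left_mono mult_left_mono power_mono) auto
    also have "\<dots> = c * (1 + 2 ^ Suc d) * real n * real n ^ d"
      by (simp add: algebra_simps power_mult_distrib)
    finally have "real (card (B n)) * \<bar>m n - m n'\<bar> \<le> c * (1 + 2 ^ Suc d) * real n * real n ^ d" .
    moreover have "CV * real n ^ d * \<bar>m n - m n'\<bar> \<le> real (card (B n)) * \<bar>m n - m n'\<bar>"
      using vol[OF n(1)] by (intro mult_right_mono) auto
    ultimately have "(CV * \<bar>m n - m n'\<bar>) * real n ^ d \<le> (c * (1 + 2 ^ Suc d) * real n) * real n ^ d"
      by (simp add: mult_ac)
    moreover have "0 < real n ^ d" using n N by simp
    ultimately have "CV * \<bar>m n - m n'\<bar> \<le> c * (1 + 2 ^ Suc d) * real n"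
      by (rule mult_right_le_imp_le)
    then show ?thesis using CV by (simp add: b_def field_simps)
  qed
  define A where "A = (\<Sum>i<2*N. \<bar>m i\<bar>)"
  have growth: "N \<le> n \<Longrightarrow> \<bar>m n\<bar> \<le> A + 2 * b * real n" for n
  proof (induction n rule: less_induct)
    case (less n)
    show ?case
    proof (cases "n < 2 * N")
      case True
      then have "\<bar>m n\<bar> \<le> A" unfolding A_def by (intro member_le_sum) auto
      then show ?thesis using b by (simp add: add_increasing2)
    next
      case False
      \<comment> \<open>Rounding up ensures that \<open>n\<close> is at most \<open>2 * h\<close>,
        so \<open>step\<close> applies, and \<open>3 * h\<close> is still at most
        \<open>2 * n\<close>. The latter closes the induction, since
        \<open>2 * b * h + b * h\<close> is then at most \<open>2 * b * n\<close>.\<close>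
      define h where "h = (n + 1) div 2"
      have h: "N \<le> h" "h < n" "n \<le> 2 * h" "3 * h \<le> 2 * n"
        using False N by (auto simp: h_def)
      have "\<bar>m h\<bar> \<le> A + 2 * b * real h" using less h by blast
      moreover have "\<bar>m h - m n\<bar> \<le> b * real h" using h by (intro step) auto
      moreover have "b * (3 * real h) \<le> b * (2 * real n)"
        using b h(4) by (intro mult_left_mono) auto
      ultimately show ?thesis by argo
    qed
  qed
  have "(\<Sum>x\<in>B n. \<bar>u x\<bar>) \<le> real (card (B n)) * (A + (3 + 2 * 2 ^ Suc d) * c / CV * real n)"
    if n: "N \<le> n" for n
  proof -
    have "(\<Sum>x\<in>B n. \<bar>u x\<bar>) \<le> (\<Sum>x\<in>B n. \<bar>u x - m n\<bar> + \<bar>m n\<bar>)" by (intro sum_mono) linarith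
    also have "\<dots> \<le> c * real n ^ Suc d + real (card (B n)) * (A + 2 * b * real n)"
      using m[OF n] growth[OF n] by (simp add: sum.distrib add_mono mult_left_mono)
    also have "c * real n ^ Suc d = c / CV * real n * (CV * real n ^ d)" using CV by simp
    also have "\<dots> \<le> c / CV * real n * real (card (B n))"
      using vol[OF n] c CV by (intro mult_left_mono) auto
    \<comment> \<open>The slope is \<open>c / CV\<close> from the oscillation plus
      \<open>2 * b\<close> from the centring constant.\<close>
    also have "c / CV * real n * real (card (B n)) + real (card (B n)) * (A + 2 * b * real n)
        = real (card (B n)) * (A + (3 + 2 * 2 ^ Suc d) * c / CV * real n)"
      using CV by (simp add: b_def field_simps)
    finally show ?thesis by simp
  qed
  then show ?thesis by blast
qed

section \<open>Stationarity and the maximal inequality\<close>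

lemma stationary_integral:
  fixes g :: "('d::finite) env \<Rightarrow> real"
  assumes "sets P = sets env_space" "stationary P" "integrable P g"
  shows "integrable P (\<lambda>\<omega>. g (shift z \<omega>))" "(\<integral>\<omega>. g (shift z \<omega>) \<partial>P) = (\<integral>\<omega>. g \<omega> \<partial>P)"
proof -
  have [measurable_cong]: "sets P = sets env_space" by fact
  have T[measurable]: "shift z \<in> P \<rightarrow>\<^sub>M env_space"
    using measurable_shift by (simp cong: measurable_cong_sets add: assms(1))
  have D: "distr P env_space (shift z) = P" using assms by (simp add: stationary_def)
  have g: "g \<in> borel_measurable env_space"
    using borel_measurable_integrable[OF assms(3)] by simp
  show "integrable P (\<lambda>\<omega>. g (shift z \<omega>))"
    using integrable_distr_eq[OF T g] D assms(3) by simp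
  show "(\<integral>\<omega>. g (shift z \<omega>) \<partial>P) = (\<integral>\<omega>. g \<omega> \<partial>P)"
    using integral_distr[OF T g] D by simp
qed

text \<open>
  The counting estimate is applied to the points of \<open>cube N\<close>, and stationarity transfers it to
  probabilities. The balls used lie in \<open>cube (2 * N)\<close>, which costs a factor \<open>2 ^ CARD('d)\<close>.
\<close>

lemma maximal_inequality:
  fixes P :: "('d::finite) env measure"
  assumes prob: "prob_space P" and sets_P: "sets P = sets env_space" and stat: "stationary P"
    and int: "integrable P g" and nonneg: "\<And>\<omega>. 0 \<le> g \<omega>" and kap: "0 \<le> \<kappa>"
  defines "bad \<equiv> \<lambda>n \<omega>. \<kappa> * real n ^ CARD('d) < (\<Sum>x\<in>cube n. g (shift x \<omega>))"
  shows "{\<omega> \<in> space P. \<exists>n\<ge>1. bad n \<omega>} \<in> sets P"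
    and "\<kappa> * measure P {\<omega> \<in> space P. \<exists>n\<ge>1. bad n \<omega>} \<le> 10 ^ CARD('d) * (\<integral>\<omega>. g \<omega> \<partial>P)"
proof -
  interpret prob_space P by fact
  have [measurable]: "(\<lambda>\<omega>. g (shift z \<omega>)) \<in> borel_measurable P" for z
    using stationary_integral(1)[OF sets_P stat int] by (rule borel_measurable_integrable)
  show meas: "{\<omega> \<in> space P. \<exists>n\<ge>1. bad n \<omega>} \<in> sets P"
    unfolding bad_def by measurable
  \<comment> \<open>Radii are truncated at \<open>N\<close> so that only finitely many translates
    occur; the bound obtained does not depend on \<open>N\<close>.\<close>
  define A where "A N = {\<omega> \<in> space P. \<exists>n\<in>{1..N}. bad n \<omega>}" for N
  have A[measurable]: "A N \<in> sets P" for N unfolding A_def bad_def by measurable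
  have space_P: "space P = space env_space" using sets_P by (rule sets_eq_imp_space_eq)
  have bound: "\<kappa> * measure P (A N) \<le> 10 ^ CARD('d) * (\<integral>\<omega>. g \<omega> \<partial>P)" for N
  proof -
    have count: "\<kappa> * (\<Sum>x\<in>cube N. indicator (A N) (shift x \<omega>))
        \<le> 5 ^ CARD('d) * (\<Sum>y\<in>cube (2 * N). g (shift y \<omega>))" if \<omega>: "\<omega> \<in> space P" for \<omega>
    proof -
      define E where "E = {x \<in> cube N. shift x \<omega> \<in> A N}"
      have "\<forall>x\<in>E. \<exists>n\<in>{1..N}. bad n (shift x \<omega>)" by (auto simp: E_def A_def)
      then obtain r where r: "\<And>x. x \<in> E \<Longrightarrow> r x \<in> {1..N} \<and> bad (r x) (shift x \<omega>)" by metis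
      have "\<kappa> * real (card E) \<le> 5 ^ CARD('d) * (\<Sum>y\<in>(\<Union>x\<in>E. (+) x ` cube (r x)). g (shift y \<omega>))"
      proof (rule vitali_counting)
        show "finite E" by (auto simp: E_def finite_cube)
        fix x assume x: "x \<in> E"
        show "1 \<le> r x" using r[OF x] by simp
        \<comment> \<open>Since shifts compose additively, a cube average seen from
          \<open>shift x \<omega>\<close> is an average of the original environment over the
          translated cube.\<close>
        have "(\<Sum>y\<in>(+) x ` cube (r x). g (shift y \<omega>)) = (\<Sum>y\<in>cube (r x). g (shift y (shift x \<omega>)))"
          by (simp add: sum.reindex shift_shift)
        then show "\<kappa> * real (r x) ^ CARD('d) \<le> (\<Sum>y\<in>(+) x ` cube (r x). g (shift y \<omega>))"
          using r[OF x] by (simp add: bad_def)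
      qed (auto simp: nonneg kap)
      also have "\<dots> \<le> 5 ^ CARD('d) * (\<Sum>y\<in>cube (2 * N). g (shift y \<omega>))"
      proof (intro mult_left_mono sum_mono2 finite_cube nonneg)
        show "(\<Union>x\<in>E. (+) x ` cube (r x)) \<subseteq> cube (2 * N)"
        proof clarify
          fix x y :: "int ^ 'd" assume xy: "x \<in> E" "y \<in> cube (r x)"
          have "y \<in> cube N" using xy r[OF xy(1)] cube_mono[of "r x" N] by auto
          moreover have "x \<in> cube N" using xy by (simp add: E_def)
          ultimately have "\<bar>x $ i\<bar> + \<bar>y $ i\<bar> \<le> int N + int N" for i
            unfolding cube_def by (intro add_mono) auto
          then show "x + y \<in> cube (2 * N)"
            unfolding cube_def by (auto intro: order_trans[OF abs_triangle_ineq])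
        qed
      qed auto
      also have "real (card E) = (\<Sum>x\<in>cube N. indicator (A N) (shift x \<omega>))"
      proof -
        have "real (card E) = (\<Sum>x\<in>E. 1)" by simp
        also have "\<dots> = (\<Sum>x\<in>cube N. if shift x \<omega> \<in> A N then 1 else 0)"
          unfolding E_def by (rule sum.inter_filter[OF finite_cube])
        finally show ?thesis by (simp add: indicator_def of_bool_def)
      qed
      finally show ?thesis .
    qed
    have ind: "integrable P (indicator (A N) :: _ \<Rightarrow> real)"
      by (intro integrable_real_indicator A) (simp add: emeasure_eq_measure)
    note si = stationary_integral[OF sets_P stat ind] stationary_integral[OF sets_P stat int]
    let ?d = "CARD('d)"
    have "real ((2 * N + 1) ^ ?d) * (\<kappa> * measure P (A N))
        = (\<integral>\<omega>. \<kappa> * (\<Sum>x\<in>cube N. indicator (A N) (shift x \<omega>)) \<partial>P)"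
      by (simp add: si card_cube Int_absorb2[OF sets.sets_into_space[OF A]] del: of_nat_power)
    also have "\<dots> \<le> (\<integral>\<omega>. 5 ^ ?d * (\<Sum>y\<in>cube (2 * N). g (shift y \<omega>)) \<partial>P)"
      by (intro integral_mono count) (auto simp: si)
    also have "\<dots> = 5 ^ ?d * (real ((4 * N + 1) ^ ?d) * (\<integral>\<omega>. g \<omega> \<partial>P))"
      by (simp add: si card_cube del: of_nat_power)
    \<comment> \<open>Bounding \<open>4 * N + 1\<close> by \<open>2 * (2 * N + 1)\<close> lets the
      cardinality of \<open>cube N\<close> cancel, and leaves the constant \<open>5 * 2 = 10\<close>
      to the power of the dimension.\<close>
    also have "\<dots> \<le> 5 ^ ?d * (real ((2 * (2 * N + 1)) ^ ?d) * (\<integral>\<omega>. g \<omega> \<partial>P))"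
      by (intro mult_left_mono mult_right_mono)
        (auto simp: nonneg simp del: of_nat_power intro!: power_mono of_nat_mono)
    also have "\<dots> = real ((2 * N + 1) ^ ?d) * ((5 * 2) ^ ?d * (\<integral>\<omega>. g \<omega> \<partial>P))"
      by (simp only: power_mult_distrib of_nat_mult of_nat_power of_nat_numeral mult_ac)
    finally have "real ((2 * N + 1) ^ ?d) * (\<kappa> * measure P (A N))
        \<le> real ((2 * N + 1) ^ ?d) * (10 ^ ?d * (\<integral>\<omega>. g \<omega> \<partial>P))" by simp
    moreover have "0 < real ((2 * N + 1) ^ ?d)" by simp
    ultimately show ?thesis by (rule mult_left_le_imp_le)
  qed
  \<comment> \<open>Continuity from below removes the truncation.\<close>
  have "(\<lambda>N. measure P (A N)) \<longlonglongrightarrow> measure P (\<Union>N. A N)"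
  proof (rule finite_Lim_measure_incseq)
    show "range A \<subseteq> sets P" using A by blast
    show "incseq A" by (auto simp: incseq_def A_def)
  qed
  then have "(\<lambda>N. \<kappa> * measure P (A N)) \<longlonglongrightarrow> \<kappa> * measure P (\<Union>N. A N)" by (intro tendsto_intros)
  then have "\<kappa> * measure P (\<Union>N. A N) \<le> 10 ^ CARD('d) * (\<integral>\<omega>. g \<omega> \<partial>P)"
    by (rule LIMSEQ_le_const2) (use bound in auto)
  also have "(\<Union>N. A N) = {\<omega> \<in> space P. \<exists>n\<ge>1. bad n \<omega>}" by (force simp: A_def)
  finally show "\<kappa> * measure P {\<omega> \<in> space P. \<exists>n\<ge>1. bad n \<omega>} \<le> 10 ^ CARD('d) * (\<integral>\<omega>. g \<omega> \<partial>P)" .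
qed

section \<open>The local gradient and its expectation\<close>

text \<open>This is the function \<open>g\<close> of the outline, without conductance weights
  because the Poincare inequality counts edges. It is extended by 0 off the infinite cluster so as
  to be integrated under \<open>P\<close>, the measure for which stationarity is assumed.\<close>

definition local_gradient :: "('d::finite) field \<Rightarrow> 'd env \<Rightarrow> real" where
  "local_gradient \<Psi> \<omega> =
     (if 0 \<in> C_infty \<omega> then \<Sum>z | (z, 0) \<in> open_adj \<omega>. \<bar>\<Psi> \<omega> z\<bar> else 0)"

lemma local_gradient_nonneg: "0 \<le> local_gradient \<Psi> \<omega>"
  by (simp add: local_gradient_def sum_nonneg)

text \<open>The cocycle property turns each increment from \<open>x\<close> into a value of
  \<open>\<Psi>\<close> at the shifted environment, whose infinite cluster contains the origin
  because \<open>x\<close> lies in the original one.\<close>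

lemma local_gradient_shift:
  assumes x: "x \<in> C_infty \<omega>"
    and coc: "\<And>y. y \<in> C_infty \<omega> \<Longrightarrow> \<Psi> (shift x \<omega>) (y - x) = \<Psi> \<omega> y - \<Psi> \<omega> x"
  shows "(\<Sum>y | (y, x) \<in> open_adj \<omega> \<and> y \<in> C_infty \<omega>. \<bar>\<Psi> \<omega> x - \<Psi> \<omega> y\<bar>)
    \<le> local_gradient \<Psi> (shift x \<omega>)"
proof -
  have fin: "finite {z. (z, 0) \<in> open_adj \<omega>'}" for \<omega>' :: "'a env"
    by (simp add: open_adj_0_eq finite_unit_ball)
  have "(\<Sum>y | (y, x) \<in> open_adj \<omega> \<and> y \<in> C_infty \<omega>. \<bar>\<Psi> \<omega> x - \<Psi> \<omega> y\<bar>)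
      = (\<Sum>y | (y, x) \<in> open_adj \<omega> \<and> y \<in> C_infty \<omega>. \<bar>\<Psi> (shift x \<omega>) (y - x)\<bar>)"
    by (intro sum.cong) (auto simp: coc abs_minus_commute)
  also have "\<dots> = (\<Sum>z\<in>(\<lambda>y. y - x) ` {y. (y, x) \<in> open_adj \<omega> \<and> y \<in> C_infty \<omega>}. \<bar>\<Psi> (shift x \<omega>) z\<bar>)"
    by (simp add: sum.reindex inj_on_def)
  also have "\<dots> \<le> (\<Sum>z | (z, 0) \<in> open_adj (shift x \<omega>). \<bar>\<Psi> (shift x \<omega>) z\<bar>)"
    by (intro sum_mono2 fin) (auto simp: open_adj_shift)
  also have "\<dots> = local_gradient \<Psi> (shift x \<omega>)"
    using x by (simp add: local_gradient_def C_infty_shift)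
  finally show ?thesis .
qed

lemma P_zero_density:
  assumes "0 < measure P {\<omega> \<in> space P. 0 \<in> C_infty \<omega>}" and prob: "prob_space P"
    and f: "f \<in> borel_measurable P"
  defines "A \<equiv> {\<omega> \<in> space P. 0 \<in> C_infty \<omega>}"
  shows "integrable (P_zero P) f \<longleftrightarrow> integrable P (\<lambda>\<omega>. indicator A \<omega> * (f \<omega> :: real))"
    and "(\<integral>\<omega>. indicator A \<omega> * f \<omega> \<partial>P) = measure P A * (\<integral>\<omega>. f \<omega> \<partial>P_zero P)"
proof -
  interpret prob_space P by fact
  \<comment> \<open>Positivity yields measurability here: \<open>measure\<close> is 0 on sets
    outside the sigma-algebra.\<close>
  have A[measurable]: "A \<in> sets P"
    using assms(1) measure_notin_sets[of A P] by (auto simp: A_def)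
  have pos: "measure P A > 0" using assms(1) by (simp add: A_def)
  have eq: "P_zero P = density P (\<lambda>\<omega>. ennreal (indicator A \<omega> / measure P A))"
    unfolding P_zero_def uniform_measure_def A_def[symmetric] using pos
    by (intro arg_cong2[where f = density] refl ext)
      (auto simp: indicator_def emeasure_eq_measure divide_ennreal[symmetric])
  have "integrable (P_zero P) f \<longleftrightarrow> integrable P (\<lambda>\<omega>. (indicator A \<omega> * f \<omega>) / measure P A)"
    unfolding eq by (subst integrable_density[OF f]) (auto simp: algebra_simps)
  also have "\<dots> \<longleftrightarrow> integrable P (\<lambda>\<omega>. indicator A \<omega> * f \<omega>)"
    using pos by (simp add: divide_inverse)
  finally show "integrable (P_zero P) f \<longleftrightarrow> integrable P (\<lambda>\<omega>. indicator A \<omega> * f \<omega>)" .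
  have "(\<integral>\<omega>. f \<omega> \<partial>P_zero P) = (\<integral>\<omega>. (indicator A \<omega> * f \<omega>) / measure P A \<partial>P)"
    unfolding eq by (subst integral_density[OF f]) (auto simp: algebra_simps)
  then show "(\<integral>\<omega>. indicator A \<omega> * f \<omega> \<partial>P) = measure P A * (\<integral>\<omega>. f \<omega> \<partial>P_zero P)"
    using pos by simp
qed

lemma measurable_env_component:
  "e \<in> lattice_edges \<Longrightarrow> (\<lambda>\<omega>. \<omega> e) \<in> borel_measurable env_space"
  unfolding env_space_def
  by (rule measurable_compose[OF measurable_component_singleton, where g = "\<lambda>x. x"])
    (auto intro: measurable_restrict_space1)

lemma unit_ball_edge: "z \<in> unit_ball \<Longrightarrow> {0, z} \<in> lattice_edges"
  by (simp add: unit_ball_def)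

lemma sum_open_adj_0:
  "(\<Sum>z | (z, 0) \<in> open_adj \<omega>. h z) = (\<Sum>z\<in>unit_ball. if 0 < \<omega> {0, z} then h z else (0::real))"
  unfolding open_adj_0_eq by (simp add: sum.inter_filter finite_unit_ball)

lemma measurable_cov_form:
  fixes \<Psi> \<Psi>' :: "('d::finite) field"
  assumes "\<And>z. (\<lambda>\<omega>. \<Psi> \<omega> z) \<in> borel_measurable env_space"
    and "\<And>z. (\<lambda>\<omega>. \<Psi>' \<omega> z) \<in> borel_measurable env_space"
  shows "cov_form \<Psi> \<Psi>' \<in> borel_measurable env_space"
proof -
  note [measurable] = assms
  have [measurable]: "(\<lambda>\<omega>. \<omega> {0, z}) \<in> borel_measurable env_space"
    if "z \<in> unit_ball" for z :: "int ^ 'd"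
    using that by (intro measurable_env_component unit_ball_edge)
  have "(\<lambda>\<omega>. \<Sum>z\<in>unit_ball. if 0 < \<omega> {0, z} then \<omega> {0, z} * (\<Psi> \<omega> z * \<Psi>' \<omega> z) else 0)
      \<in> borel_measurable env_space"
    by (intro borel_measurable_sum) measurable
  then show ?thesis unfolding cov_form_def[abs_def] sum_open_adj_0 .
qed

lemma cov_form_nonneg: "0 \<le> cov_form \<Psi> \<Psi> \<omega>"
  by (auto simp: cov_form_def sum_open_adj_0 intro!: sum_nonneg)

text \<open>The integrand is estimated by \<open>\<bar>\<Psi>\<bar> \<le> s \<omega> \<Psi>\<^sup>2 + 1 / (s \<omega>)\<close>.\<close>

lemma local_gradient_integral:
  fixes P :: "('d::finite) env measure"
  assumes prob: "prob_space P" and sets_P: "sets P = sets env_space"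
    and perc: "0 < measure P {\<omega> \<in> space P. 0 \<in> C_infty \<omega>}"
    and low: "\<forall>e\<in>lattice_edges. integrable P (\<lambda>\<omega>. if \<omega> e > 0 then 1 / \<omega> e else 0)"
    and \<Psi>: "\<And>z. (\<lambda>\<omega>. \<Psi> \<omega> z) \<in> borel_measurable env_space"
    and int: "integrable (P_zero P) (cov_form \<Psi> \<Psi>)"
    and s: "0 < s"
  shows "integrable P (local_gradient \<Psi>)"
    and "(\<integral>\<omega>. local_gradient \<Psi> \<omega> \<partial>P) \<le> s * cov_inner P \<Psi> \<Psi>
      + (1 / s) * (\<Sum>z\<in>unit_ball. \<integral>\<omega>. (if \<omega> {0, z} > 0 then 1 / \<omega> {0, z} else 0) \<partial>P)"
proof -
  interpret prob_space P by fact
  have [measurable_cong]: "sets P = sets env_space" by fact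
  define A where "A = {\<omega> \<in> space P. 0 \<in> C_infty \<omega>}"
  have A[measurable]: "A \<in> sets P"
    using perc measure_notin_sets[of A P] by (auto simp: A_def)
  note [measurable] = \<Psi>
  have [measurable]: "(\<lambda>\<omega>. \<omega> {0, z}) \<in> borel_measurable env_space"
    if "z \<in> unit_ball" for z :: "int ^ 'd"
    using that by (intro measurable_env_component unit_ball_edge)
  define inv where "inv z \<omega> = (if \<omega> {0, z} > 0 then 1 / \<omega> {0, z} else (0::real))" for z and \<omega> :: "'d env"
  have inv_int: "integrable P (inv z)" if "z \<in> unit_ball" for z
    using low unit_ball_edge[OF that] unfolding inv_def by blast
  have [measurable]: "cov_form \<Psi> \<Psi> \<in> borel_measurable P"
    using measurable_cov_form[of \<Psi> \<Psi>] \<Psi> by simp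
  have cov: "integrable P (\<lambda>\<omega>. indicator A \<omega> * cov_form \<Psi> \<Psi> \<omega>)"
      "(\<integral>\<omega>. indicator A \<omega> * cov_form \<Psi> \<Psi> \<omega> \<partial>P) = measure P A * cov_inner P \<Psi> \<Psi>"
    using P_zero_density[OF perc prob, of "cov_form \<Psi> \<Psi>"] int by (simp_all add: A_def cov_inner_def)
  have meas: "local_gradient \<Psi> \<in> borel_measurable P"
  proof -
    have "(\<lambda>\<omega>. indicator A \<omega> * (\<Sum>z\<in>unit_ball. if 0 < \<omega> {0, z} then \<bar>\<Psi> \<omega> z\<bar> else 0))
        \<in> borel_measurable P"
      by (intro borel_measurable_times borel_measurable_indicator A borel_measurable_sum) measurable
    then show ?thesis
      by (rule measurable_cong[THEN iffD1, rotated])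
        (auto simp: local_gradient_def sum_open_adj_0 A_def indicator_def)
  qed
  have le: "local_gradient \<Psi> \<omega>
      \<le> s * (indicator A \<omega> * cov_form \<Psi> \<Psi> \<omega>) + (1 / s) * (\<Sum>z\<in>unit_ball. inv z \<omega>)"
    if "\<omega> \<in> space P" for \<omega>
  proof (cases "0 \<in> C_infty \<omega>")
    case True
    have am_gm: "\<bar>a\<bar> \<le> s * (w * (a * a)) + (1 / s) * (1 / w)" if "0 < w" for a w :: real
    proof -
      \<comment> \<open>The inequality \<open>2 * t \<le> t ^ 2 + 1\<close> at
        \<open>t = s * w * \<bar>a\<bar>\<close>; dividing by \<open>s * w\<close> gives the claim.
        The parameter \<open>s\<close> stays free for later balancing.\<close>
      have "2 * (s * w * \<bar>a\<bar>) * 1 \<le> (s * w * \<bar>a\<bar>)\<^sup>2 + 1\<^sup>2" by (rule sum_squares_bound)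
      moreover have "0 \<le> s * w * \<bar>a\<bar>" using s that by simp
      ultimately have "s * w * \<bar>a\<bar> \<le> (s * w * \<bar>a\<bar>)\<^sup>2 + 1" by simp
      then show ?thesis using s that by (simp add: field_simps power2_eq_square)
    qed
    have "local_gradient \<Psi> \<omega> = (\<Sum>z\<in>unit_ball. if 0 < \<omega> {0, z} then \<bar>\<Psi> \<omega> z\<bar> else 0)"
      using True by (simp add: local_gradient_def sum_open_adj_0)
    also have "\<dots> \<le> (\<Sum>z\<in>unit_ball. s * (if 0 < \<omega> {0, z} then \<omega> {0, z} * (\<Psi> \<omega> z * \<Psi> \<omega> z) else 0)
        + (1 / s) * inv z \<omega>)"
      using am_gm[of "\<omega> {0, z}" "\<Psi> \<omega> z" for z] by (intro sum_mono) (simp add: inv_def mult_ac)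
    also have "\<dots> = s * cov_form \<Psi> \<Psi> \<omega> + (1 / s) * (\<Sum>z\<in>unit_ball. inv z \<omega>)"
      by (simp add: cov_form_def sum_open_adj_0 sum.distrib sum_distrib_left)
    finally show ?thesis using True that by (simp add: A_def)
  next
    case False
    then show ?thesis
      using s by (auto simp: local_gradient_def A_def inv_def intro!: mult_nonneg_nonneg divide_nonneg_pos sum_nonneg)
  qed
  have int_R: "integrable P (\<lambda>\<omega>. s * (indicator A \<omega> * cov_form \<Psi> \<Psi> \<omega>)
      + (1 / s) * (\<Sum>z\<in>unit_ball. inv z \<omega>))"
    by (intro Bochner_Integration.integrable_add integrable_mult_right
        Bochner_Integration.integrable_sum cov inv_int)
  show int_lg: "integrable P (local_gradient \<Psi>)"
    using le local_gradient_nonneg[of \<Psi>]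
    by (intro Bochner_Integration.integrable_bound[OF int_R meas] AE_I2) (fastforce intro: order_trans)
  have "0 \<le> cov_inner P \<Psi> \<Psi>"
    unfolding cov_inner_def by (intro integral_nonneg_AE AE_I2 cov_form_nonneg)
  then have "measure P A * cov_inner P \<Psi> \<Psi> \<le> cov_inner P \<Psi> \<Psi>"
    by (intro mult_left_le_one_le) auto
  have "(\<integral>\<omega>. local_gradient \<Psi> \<omega> \<partial>P) \<le> (\<integral>\<omega>. s * (indicator A \<omega> * cov_form \<Psi> \<Psi> \<omega>)
      + (1 / s) * (\<Sum>z\<in>unit_ball. inv z \<omega>) \<partial>P)"
    by (intro integral_mono int_lg int_R le)
  also have "\<dots> = s * (\<integral>\<omega>. indicator A \<omega> * cov_form \<Psi> \<Psi> \<omega> \<partial>P)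
      + (1 / s) * (\<Sum>z\<in>unit_ball. \<integral>\<omega>. inv z \<omega> \<partial>P)"
    using cov(1) inv_int by (subst Bochner_Integration.integral_add) auto
  also have "\<dots> \<le> s * cov_inner P \<Psi> \<Psi> + (1 / s) * (\<Sum>z\<in>unit_ball. \<integral>\<omega>. inv z \<omega> \<partial>P)"
    using s \<open>measure P A * cov_inner P \<Psi> \<Psi> \<le> cov_inner P \<Psi> \<Psi>\<close> by (simp add: cov(2))
  finally show "(\<integral>\<omega>. local_gradient \<Psi> \<omega> \<partial>P) \<le> s * cov_inner P \<Psi> \<Psi>
      + (1 / s) * (\<Sum>z\<in>unit_ball. \<integral>\<omega>. (if \<omega> {0, z} > 0 then 1 / \<omega> {0, z} else 0) \<partial>P)"
    unfolding inv_def .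
qed

lemma L2_cov_measurable:
  assumes "\<Psi> \<in> L2_cov P"
  shows "(\<lambda>\<omega>. \<Psi> \<omega> z) \<in> borel_measurable env_space"
proof -
  have "(\<lambda>(\<omega>, x). \<Psi> \<omega> x) \<in> borel_measurable (env_space \<Otimes>\<^sub>M count_space UNIV)"
    using assms by (simp add: L2_cov_def)
  then show ?thesis
    using measurable_compose[OF measurable_Pair2'[of z "count_space UNIV" env_space]] by fastforce
qed

lemma D_grad_measurable:
  assumes "bounded_local \<phi>"
  shows "(\<lambda>\<omega>. D_grad \<phi> \<omega> z) \<in> borel_measurable env_space"
proof -
  have \<phi>: "\<phi> \<in> borel_measurable env_space" using assms by (simp add: bounded_local_def)
  show ?thesis
    unfolding D_grad_def by (intro borel_measurable_diff measurable_compose[OF measurable_shift \<phi>] \<phi>)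
qed

lemma integrable_P_zero:
  fixes f :: "('d::finite) env \<Rightarrow> real"
  assumes "0 < measure P {\<omega> \<in> space P. 0 \<in> C_infty \<omega>}" "prob_space P" "integrable P f"
  shows "integrable (P_zero P) f"
proof -
  let ?A = "{\<omega> \<in> space P. 0 \<in> C_infty \<omega>}"
  have "?A \<in> sets P" using assms(1) measure_notin_sets[of ?A P] by auto
  then have "integrable P (\<lambda>\<omega>. indicator ?A \<omega> * f \<omega>)"
    using integrable_mult_indicator[OF _ assms(3)] by simp
  then show ?thesis using P_zero_density(1)[OF assms(1,2) borel_measurable_integrable[OF assms(3)]] by simp
qed

text \<open>A bounded function has a gradient of finite energy because the conductances have finite
  mean. Integrability must be secured before smallness of \<open>cov_norm\<close> can be used: the
  Bochner integral behind that norm is 0 for nonintegrable functions.\<close>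

lemma integrable_cov_form_diff_D_grad:
  fixes P :: "('d::finite) env measure"
  assumes prob: "prob_space P" and sets_P: "sets P = sets env_space"
    and perc: "0 < measure P {\<omega> \<in> space P. 0 \<in> C_infty \<omega>}"
    and upper: "\<forall>e\<in>lattice_edges. integrable P (\<lambda>\<omega>. \<omega> e)"
    and \<Psi>: "\<Psi> \<in> L2_cov P" and \<phi>: "bounded_local \<phi>"
  defines "\<Psi>' \<equiv> \<lambda>\<omega> x. \<Psi> \<omega> x - D_grad \<phi> \<omega> x"
  shows "integrable (P_zero P) (cov_form \<Psi>' \<Psi>')"
proof -
  have sets0: "sets (P_zero P) = sets env_space" by (simp add: P_zero_def sets_P)
  have space0: "space (P_zero P) = space env_space" using sets0 by (rule sets_eq_imp_space_eq)
  have [measurable]: "(\<lambda>\<omega>. \<Psi> \<omega> z) \<in> borel_measurable env_space"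
      "(\<lambda>\<omega>. \<Psi>' \<omega> z) \<in> borel_measurable env_space" for z
    using L2_cov_measurable[OF \<Psi>] D_grad_measurable[OF \<phi>] by (auto simp: \<Psi>'_def)
  have meas: "cov_form \<Psi> \<Psi> \<in> borel_measurable (P_zero P)"
      "cov_form \<Psi>' \<Psi>' \<in> borel_measurable (P_zero P)"
    unfolding measurable_cong_sets[OF sets0 refl] by (intro measurable_cov_form; measurable)+
  have int\<Psi>: "integrable (P_zero P) (cov_form \<Psi> \<Psi>)"
    using \<Psi> meas(1) by (intro integrableI_nonneg) (auto simp: cov_form_nonneg L2_cov_def)
  obtain K where K: "\<And>\<omega>. \<omega> \<in> space env_space \<Longrightarrow> \<bar>\<phi> \<omega>\<bar> \<le> K"
    using \<phi> by (auto simp: bounded_local_def)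
  have le: "cov_form \<Psi>' \<Psi>' \<omega> \<le> 2 * cov_form \<Psi> \<Psi> \<omega> + (\<Sum>z\<in>unit_ball. 8 * K\<^sup>2 * \<omega> {0, z})"
    if \<omega>: "\<omega> \<in> space env_space" for \<omega>
  proof -
    have D: "(D_grad \<phi> \<omega> z)\<^sup>2 \<le> (2 * K)\<^sup>2" for z
      using K[OF \<omega>] K[OF shift_in_space[OF \<omega>], of z] by (intro abs_le_square_iff[THEN iffD1])
        (simp add: D_grad_def abs_le_iff)
    \<comment> \<open>From \<open>(a - b) ^ 2 \<le> 2 * a ^ 2 + 2 * b ^ 2\<close> with
      \<open>\<bar>b\<bar> \<le> 2 * K\<close>.\<close>
    have sq: "\<Psi>' \<omega> z * \<Psi>' \<omega> z \<le> 2 * (\<Psi> \<omega> z * \<Psi> \<omega> z) + 8 * K\<^sup>2" for z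
    proof -
      have "0 \<le> (\<Psi> \<omega> z + D_grad \<phi> \<omega> z)\<^sup>2" by simp
      then have "\<Psi>' \<omega> z * \<Psi>' \<omega> z \<le> 2 * (\<Psi> \<omega> z * \<Psi> \<omega> z) + 2 * (D_grad \<phi> \<omega> z)\<^sup>2"
        unfolding \<Psi>'_def power2_eq_square by (simp add: algebra_simps)
      then show ?thesis using D[of z] by (simp add: power_mult_distrib)
    qed
    have "cov_form \<Psi>' \<Psi>' \<omega> \<le> (\<Sum>z\<in>unit_ball.
        2 * (if 0 < \<omega> {0, z} then \<omega> {0, z} * (\<Psi> \<omega> z * \<Psi> \<omega> z) else 0) + 8 * K\<^sup>2 * \<omega> {0, z})"
      unfolding cov_form_def sum_open_adj_0
    proof (intro sum_mono)
      fix z :: "int ^ 'd" assume "z \<in> unit_ball"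
      then have "0 \<le> \<omega> {0, z}" using env_nonneg[OF \<omega>] unit_ball_edge by blast
      then show "(if 0 < \<omega> {0, z} then \<omega> {0, z} * (\<Psi>' \<omega> z * \<Psi>' \<omega> z) else 0)
        \<le> 2 * (if 0 < \<omega> {0, z} then \<omega> {0, z} * (\<Psi> \<omega> z * \<Psi> \<omega> z) else 0) + 8 * K\<^sup>2 * \<omega> {0, z}"
        using mult_left_mono[OF sq, of "\<omega> {0, z}" z] by (simp add: algebra_simps)
    qed
    then show ?thesis by (simp add: cov_form_def sum_open_adj_0 sum.distrib sum_distrib_left)
  qed
  have intR: "integrable (P_zero P) (\<lambda>\<omega>. 2 * cov_form \<Psi> \<Psi> \<omega> + (\<Sum>z\<in>unit_ball. 8 * K\<^sup>2 * \<omega> {0, z}))"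
    using upper unit_ball_edge
    by (intro Bochner_Integration.integrable_add integrable_mult_right int\<Psi>
        Bochner_Integration.integrable_sum integrable_P_zero[OF perc prob]) blast
  show ?thesis
  proof (rule Bochner_Integration.integrable_bound[OF intR meas(2) AE_I2])
    fix \<omega> assume "\<omega> \<in> space (P_zero P)"
    then show "norm (cov_form \<Psi>' \<Psi>' \<omega>)
        \<le> norm (2 * cov_form \<Psi> \<Psi> \<omega> + (\<Sum>z\<in>unit_ball. 8 * K\<^sup>2 * \<omega> {0, z}))"
      using le[of \<omega>] cov_form_nonneg[of \<Psi>' \<omega>] space0 by simp
  qed
qed

section \<open>Approximation by gradients and the conclusion\<close>

text \<open>Choose a sequence of local functions whose bad events have probabilities tending to 0.
  Almost every environment escapes at least one of these events. The local function obtained depends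
  on the environment, which is harmless as the final estimate is made for a fixed
  environment.\<close>

lemma L2_pot_small_maximal_gradient:
  fixes P :: "('d::finite) env measure"
  assumes prob: "prob_space P" and sets_P: "sets P = sets env_space" and stat: "stationary P"
    and perc: "0 < measure P {\<omega> \<in> space P. 0 \<in> C_infty \<omega>}"
    and upper: "\<forall>e\<in>lattice_edges. integrable P (\<lambda>\<omega>. \<omega> e)"
    and lower: "\<forall>e\<in>lattice_edges. integrable P (\<lambda>\<omega>. if \<omega> e > 0 then 1 / \<omega> e else 0)"
    and \<Psi>: "\<Psi> \<in> L2_pot P" and kap: "0 < \<kappa>"
  shows "AE \<omega> in P. \<exists>\<phi>. bounded_local \<phi> \<and> (\<forall>n\<ge>1.
    (\<Sum>x\<in>cube n. local_gradient (\<lambda>\<omega> x. \<Psi> \<omega> x - D_grad \<phi> \<omega> x) (shift x \<omega>))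
    \<le> \<kappa> * real n ^ CARD('d))"
proof -
  interpret prob_space P by fact
  define g where "g \<phi> = local_gradient (\<lambda>\<omega> x. \<Psi> \<omega> x - D_grad \<phi> \<omega> x)" for \<phi>
  define bad where "bad \<phi> = {\<omega> \<in> space P.
    \<exists>n\<ge>1. \<kappa> * real n ^ CARD('d) < (\<Sum>x\<in>cube n. g \<phi> (shift x \<omega>))}" for \<phi>
  have cov: "\<Psi> \<in> L2_cov P" using \<Psi> by (simp add: L2_pot_def)
  have small: "\<exists>\<phi>. bounded_local \<phi> \<and> integrable P (g \<phi>) \<and> (\<integral>\<omega>. g \<phi> \<omega> \<partial>P) \<le> \<delta>"
    if \<delta>: "0 < \<delta>" for \<delta>
  proof -
    define L where "L = (\<Sum>z\<in>unit_ball. \<integral>\<omega>. (if \<omega> {0, z :: int ^ 'd} > 0 then 1 / \<omega> {0, z} else 0) \<partial>P)"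
    have L: "0 \<le> L" unfolding L_def by (intro sum_nonneg integral_nonneg_AE) auto
    \<comment> \<open>The term \<open>L / s\<close> becomes at most \<open>\<delta> / 2\<close>,
      where the added 1 keeps \<open>s\<close> positive if \<open>L = 0\<close>. As \<open>L\<close>
      does not involve \<open>\<phi>\<close>, the function can be chosen afterwards, with energy
      below \<open>\<delta> / (2 * s)\<close>.\<close>
    define s where "s = (2 * L + 1) / \<delta>"
    have s: "0 < s" using L \<delta> by (simp add: s_def)
    have "0 < sqrt (\<delta> / (2 * s))" using s \<delta> by simp
    then obtain \<phi> where \<phi>: "bounded_local \<phi>"
      "cov_norm P (\<lambda>\<omega> x. \<Psi> \<omega> x - D_grad \<phi> \<omega> x) < sqrt (\<delta> / (2 * s))"
      using \<Psi> unfolding L2_pot_def by blast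
    have "(\<lambda>\<omega>. \<Psi> \<omega> z - D_grad \<phi> \<omega> z) \<in> borel_measurable env_space" for z
      by (intro borel_measurable_diff L2_cov_measurable[OF cov] D_grad_measurable \<phi>)
    note lg = local_gradient_integral[OF prob sets_P perc lower this
        integrable_cov_form_diff_D_grad[OF prob sets_P perc upper cov \<phi>(1)] s]
    have "(1 / s) * L \<le> \<delta> / 2" using L \<delta> by (simp add: s_def field_simps)
    moreover have "s * cov_inner P (\<lambda>\<omega> x. \<Psi> \<omega> x - D_grad \<phi> \<omega> x) (\<lambda>\<omega> x. \<Psi> \<omega> x - D_grad \<phi> \<omega> x) \<le> \<delta> / 2"
      using \<phi>(2) s by (simp add: cov_norm_def field_simps)
    ultimately have "(\<integral>\<omega>. g \<phi> \<omega> \<partial>P) \<le> \<delta>"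
      using lg(2) unfolding g_def L_def by linarith
    then show ?thesis using \<phi>(1) lg(1) unfolding g_def by blast
  qed
  have "\<exists>\<phi>. bounded_local \<phi> \<and> bad \<phi> \<in> sets P \<and> measure P (bad \<phi>) \<le> 1 / real (Suc k)" for k
  proof -
    \<comment> \<open>Chosen to cancel the constant of the maximal inequality.\<close>
    define \<delta> where "\<delta> = \<kappa> / (real (Suc k) * 10 ^ CARD('d))"
    have "0 < \<delta>" using kap by (simp add: \<delta>_def)
    then obtain \<phi> where \<phi>: "bounded_local \<phi>" "integrable P (g \<phi>)" "(\<integral>\<omega>. g \<phi> \<omega> \<partial>P) \<le> \<delta>"
      using small by blast
    note mi = maximal_inequality[OF prob sets_P stat \<phi>(2), of \<kappa>, folded bad_def]
    have nn: "\<And>\<omega>. 0 \<le> g \<phi> \<omega>" by (simp add: g_def local_gradient_nonneg)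
    have "\<kappa> * measure P (bad \<phi>) \<le> 10 ^ CARD('d) * (\<integral>\<omega>. g \<phi> \<omega> \<partial>P)" using mi(2) nn kap by simp
    also have "\<dots> \<le> 10 ^ CARD('d) * \<delta>" using \<phi>(3) by simp
    also have "\<dots> = \<kappa> * (1 / real (Suc k))" by (simp add: \<delta>_def)
    finally have "measure P (bad \<phi>) \<le> 1 / real (Suc k)" using kap by (rule mult_left_le_imp_le)
    then show ?thesis using \<phi>(1) mi(1) nn kap by auto
  qed
  then obtain \<phi> where \<phi>: "\<And>k. bounded_local (\<phi> k)" "\<And>k. bad (\<phi> k) \<in> sets P"
    "\<And>k. measure P (bad (\<phi> k)) \<le> 1 / real (Suc k)" by metis
  have meas: "(\<Inter>k. bad (\<phi> k)) \<in> sets P" using \<phi>(2) by auto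
  have "measure P (\<Inter>k. bad (\<phi> k)) \<le> 1 / real (Suc k)" for k
    using finite_measure_mono[OF _ \<phi>(2), of "\<Inter>k. bad (\<phi> k)" k] \<phi>(3)[of k] by force
  moreover have "(\<lambda>k. 1 / real (Suc k)) \<longlonglongrightarrow> 0" using LIMSEQ_inverse_real_of_nat by (simp add: inverse_eq_divide)
  ultimately have "measure P (\<Inter>k. bad (\<phi> k)) \<le> 0" by (intro LIMSEQ_le_const) auto
  then have "(\<Inter>k. bad (\<phi> k)) \<in> null_sets P"
    using meas by (simp add: null_setsI emeasure_eq_measure measure_le_0_iff)
  then have "AE \<omega> in P. \<omega> \<notin> (\<Inter>k. bad (\<phi> k))" by (rule AE_not_in)
  then show ?thesis
  proof (rule AE_mp[OF _ AE_I2], intro impI)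
    fix \<omega> assume "\<omega> \<in> space P" "\<omega> \<notin> (\<Inter>k. bad (\<phi> k))"
    then obtain k where "\<omega> \<notin> bad (\<phi> k)" by auto
    then show "\<exists>\<phi>. bounded_local \<phi> \<and> (\<forall>n\<ge>1. (\<Sum>x\<in>cube n. local_gradient
        (\<lambda>\<omega> x. \<Psi> \<omega> x - D_grad \<phi> \<omega> x) (shift x \<omega>)) \<le> \<kappa> * real n ^ CARD('d))"
      using \<phi>(1)[of k] \<open>\<omega> \<in> space P\<close> by (intro exI[of _ "\<phi> k"]) (auto simp: bad_def g_def not_less)
  qed
qed

text \<open>A deterministic estimate in one environment. The constant \<open>C\<close> depends
  neither on \<open>\<phi>\<close> nor on \<open>\<kappa>\<close>; everything depending on
  \<open>\<phi>\<close> is collected in \<open>A\<close> and is divided by \<open>n\<close>.\<close>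

lemma cluster_average_bound:
  fixes \<Psi> :: "('d::finite) field"
  assumes const: "0 < CV" "0 < Criso" "CW \<le> real W" "1 \<le> W" "\<theta> < 1" "0 \<le> \<kappa>"
    and \<omega>: "\<omega> \<in> space env_space" and inf: "0 \<in> C_infty \<omega>"
    and reg: "\<forall>n\<ge>N0. very_regular CV Criso CW \<theta> \<omega> n"
    and coc: "\<forall>x\<in>C_infty \<omega>. \<forall>y\<in>C_infty \<omega>. \<Psi> (shift x \<omega>) (y - x) = \<Psi> \<omega> y - \<Psi> \<omega> x"
    and \<phi>: "bounded_local \<phi>"
    and grad: "\<forall>n\<ge>1. (\<Sum>x\<in>cube n. local_gradient (\<lambda>\<omega> x. \<Psi> \<omega> x - D_grad \<phi> \<omega> x) (shift x \<omega>))
      \<le> \<kappa> * real n ^ CARD('d)"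
  defines "C \<equiv> (3 + 2 * 2 ^ Suc CARD('d)) * (2 * real W ^ CARD('d) / Criso) / CV"
  shows "\<exists>A. \<forall>n\<ge>max 1 N0. 1 / real (card (cluster_ball \<omega> 0 (real n))) *
       (\<Sum>x\<in>cluster_ball \<omega> 0 (real n). \<bar>1 / real n * \<Psi> \<omega> x\<bar>) \<le> A / real n + C * \<kappa>"
proof -
  let ?d = "CARD('d)"
  let ?B = "\<lambda>n. cluster_ball \<omega> 0 (real n)"
  define \<Psi>' where "\<Psi>' \<omega> x = \<Psi> \<omega> x - D_grad \<phi> \<omega> x" for \<omega> x
  define c where "c = 2 * real W ^ ?d / Criso * \<kappa>"
  \<comment> \<open>\<open>D_grad \<phi>\<close> satisfies the cocycle identity in every
    environment, by composition of shifts.\<close>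
  have coc': "\<Psi>' (shift x \<omega>) (y - x) = \<Psi>' \<omega> y - \<Psi>' \<omega> x" if "x \<in> C_infty \<omega>" "y \<in> C_infty \<omega>" for x y
    using coc that by (simp add: \<Psi>'_def D_grad_def shift_shift)
  have regn: "regular_ball CV Criso CW \<omega> 0 n" if n: "max 1 N0 \<le> n" for n
  proof -
    \<comment> \<open>The exponent is at most 1, so radius \<open>n\<close> itself is admissible in
      \<open>very_regular\<close>; it is used at the origin.\<close>
    have "real n powr (\<theta> / real ?d) \<le> real n powr 1"
      using n const(5) by (intro powr_mono) (auto simp: divide_le_eq_1 intro: order_trans[of _ 1])
    then have "real n powr (\<theta> / real ?d) \<le> real n" using n by simp
    then show ?thesis
      using reg n zero_in_cluster_ball[OF inf, of n] unfolding very_regular_def by auto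
  qed
  have osc: "\<exists>m. (\<Sum>x\<in>?B n. \<bar>\<Psi>' \<omega> x - m\<bar>) \<le> c * real n ^ Suc ?d" if n: "max 1 N0 \<le> n" for n
  proof -
    have "\<exists>m. (\<Sum>x\<in>?B n. \<bar>\<Psi>' \<omega> x - m\<bar>)
        \<le> 2 * real n / Criso * (\<Sum>x\<in>cube (W * n). local_gradient \<Psi>' (shift x \<omega>))"
      using n const coc' by (intro regular_ball_poincare[OF regn[OF n]]
          local_gradient_nonneg local_gradient_shift) auto
    then obtain m where m: "(\<Sum>x\<in>?B n. \<bar>\<Psi>' \<omega> x - m\<bar>)
        \<le> 2 * real n / Criso * (\<Sum>x\<in>cube (W * n). local_gradient \<Psi>' (shift x \<omega>))" ..
    \<comment> \<open>The maximal bound is taken at scale \<open>W * n\<close>, which explains the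
      power of \<open>W\<close> in \<open>c\<close>.\<close>
    have "1 \<le> W * n" using const(4) n by simp
    then have "(\<Sum>x\<in>cube (W * n). local_gradient \<Psi>' (shift x \<omega>)) \<le> \<kappa> * real (W * n) ^ ?d"
      using grad unfolding \<Psi>'_def[abs_def] by blast
    then have "2 * real n / Criso * (\<Sum>x\<in>cube (W * n). local_gradient \<Psi>' (shift x \<omega>))
        \<le> 2 * real n / Criso * (\<kappa> * real (W * n) ^ ?d)"
      using const by (intro mult_left_mono) auto
    also have "\<dots> = c * real n ^ Suc ?d" by (simp add: c_def power_mult_distrib)
    finally show ?thesis using m by (intro exI[of _ m]) linarith
  qed
  have vol: "CV * real n ^ ?d \<le> real (card (?B n))" if "max 1 N0 \<le> n" for n
    using regn[OF that] by (simp add: regular_ball_def)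
  have "0 \<le> c" using const by (simp add: c_def)
  obtain A where A: "\<And>n. max 1 N0 \<le> n \<Longrightarrow> (\<Sum>x\<in>?B n. \<bar>\<Psi>' \<omega> x\<bar>)
      \<le> real (card (?B n)) * (A + (3 + 2 * 2 ^ Suc ?d) * c / CV * real n)"
    using linear_growth_of_means[of ?B "max 1 N0" CV c ?d "\<Psi>' \<omega>",
        OF finite_cluster_ball cluster_ball_mono _ const(1) \<open>0 \<le> c\<close> vol osc] by auto
  obtain K where K: "\<And>\<omega>. \<omega> \<in> space env_space \<Longrightarrow> \<bar>\<phi> \<omega>\<bar> \<le> K"
    using \<phi> by (auto simp: bounded_local_def)
  have Cc: "(3 + 2 * 2 ^ Suc ?d) * c / CV = C * \<kappa>" by (simp add: C_def c_def)
  have "1 / real (card (?B n)) * (\<Sum>x\<in>?B n. \<bar>1 / real n * \<Psi> \<omega> x\<bar>) \<le> (A + 2 * K) / real n + C * \<kappa>"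
    if n: "max 1 N0 \<le> n" for n
  proof -
    have "0 < CV * real n ^ ?d" using const n by simp
    then have pos: "0 < real (card (?B n))" using vol[OF n] by linarith
    \<comment> \<open>Restoring the gradient costs at most \<open>2 * K\<close>, uniformly in
      \<open>x\<close> and \<open>n\<close>.\<close>
    have "\<bar>\<Psi> \<omega> x\<bar> \<le> \<bar>\<Psi>' \<omega> x\<bar> + 2 * K" for x
      using K[OF \<omega>] K[OF shift_in_space[OF \<omega>], of x] unfolding \<Psi>'_def D_grad_def by linarith
    then have "(\<Sum>x\<in>?B n. \<bar>\<Psi> \<omega> x\<bar>) \<le> (\<Sum>x\<in>?B n. \<bar>\<Psi>' \<omega> x\<bar> + 2 * K)" by (intro sum_mono)
    also have "\<dots> \<le> real (card (?B n)) * (A + C * \<kappa> * real n) + real (card (?B n)) * (2 * K)"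
      using A[OF n] unfolding Cc by (simp add: sum.distrib)
    finally have *: "(\<Sum>x\<in>?B n. \<bar>\<Psi> \<omega> x\<bar>) \<le> real (card (?B n)) * (A + 2 * K + C * \<kappa> * real n)"
      by (simp add: algebra_simps)
    have "1 / real (card (?B n)) * (\<Sum>x\<in>?B n. \<bar>1 / real n * \<Psi> \<omega> x\<bar>)
        = (\<Sum>x\<in>?B n. \<bar>\<Psi> \<omega> x\<bar>) / (real (card (?B n)) * real n)"
      by (simp add: abs_mult sum_divide_distrib[symmetric])
    also have "\<dots> \<le> real (card (?B n)) * (A + 2 * K + C * \<kappa> * real n) / (real (card (?B n)) * real n)"
      using * by (intro divide_right_mono) auto
    also have "\<dots> = (A + 2 * K) / real n + C * \<kappa>"
      using pos n by (simp add: add_divide_distrib)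
    finally show ?thesis .
  qed
  then show ?thesis by blast
qed

theorem proposition2p9:
  fixes P :: "('d::finite) env measure"
    and \<theta> CV Criso CW :: real
    and chi :: "'d \<Rightarrow> 'd field"
  assumes dim: "CARD('d) \<ge> 2"
    and prob: "prob_space P"
    and sets_P: "sets P = sets env_space"
    and stat: "stationary P"
    and erg: "ergodic P"
    and upper_moment: "\<forall>e\<in>lattice_edges. integrable P (\<lambda>\<omega>. \<omega> e)"
    and unique: "AE \<omega> in P. connected_set \<omega> (C_infty \<omega>)"
    and perc: "measure P {\<omega> \<in> space P. 0 \<in> C_infty \<omega>} > 0"
    and CV: "0 < CV" "CV \<le> 1"
    and Criso: "0 < Criso"
    and CW: "1 \<le> CW"
    and theta: "0 < \<theta>" "\<theta> < 1"
    and regular: "AE \<omega> in P_zero P. \<exists>N0. \<forall>n\<ge>N0. very_regular CV Criso CW \<theta> \<omega> n"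
    and lower_moment: "\<forall>e\<in>lattice_edges. integrable P (\<lambda>\<omega>. if \<omega> e > 0 then 1 / \<omega> e else 0)"
    and corr: "is_corrector P chi"
  shows "\<forall>j. AE \<omega> in P_zero P.
    (\<lambda>n::nat. 1 / real (card (cluster_ball \<omega> 0 (real n))) *
       (\<Sum>x\<in>cluster_ball \<omega> 0 (real n). \<bar>1 / real n * chi j \<omega> x\<bar>)) \<longlonglongrightarrow> 0"
proof
  fix j
  have pot: "chi j \<in> L2_pot P" using corr by (simp add: is_corrector_def)
  let ?A = "{\<omega> \<in> space P. 0 \<in> C_infty \<omega>}"
  have A: "?A \<in> sets P" using perc measure_notin_sets[of ?A P] by auto
  have space_P: "space P = space env_space" using sets_P by (rule sets_eq_imp_space_eq)
  define small where "small \<kappa> \<omega> \<longleftrightarrow> (\<exists>\<phi>. bounded_local \<phi> \<and> (\<forall>n\<ge>1.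
    (\<Sum>x\<in>cube n. local_gradient (\<lambda>\<omega> x. chi j \<omega> x - D_grad \<phi> \<omega> x) (shift x \<omega>))
      \<le> \<kappa> * real n ^ CARD('d)))"
    for \<kappa> \<omega>
  \<comment> \<open>Restricting \<open>\<kappa>\<close> to the values \<open>1 / (k + 1)\<close>
    leaves countably many exceptional null sets.\<close>
  have "AE \<omega> in P. \<forall>k::nat. small (1 / real (Suc k)) \<omega>"
    unfolding AE_all_countable small_def
    by (intro allI L2_pot_small_maximal_gradient[OF prob sets_P stat perc upper_moment
        lower_moment pot]) simp
  then have "AE \<omega> in P_zero P. \<forall>k::nat. small (1 / real (Suc k)) \<omega>"
    unfolding P_zero_def by (intro AE_uniform_measureI[OF A]) auto
  moreover have "AE \<omega> in P_zero P. \<omega> \<in> ?A"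
    unfolding P_zero_def by (intro AE_uniform_measureI[OF A]) auto
  moreover have "cocycle P (chi j)" using pot by (simp add: L2_pot_def L2_cov_def)
  ultimately show "AE \<omega> in P_zero P. (\<lambda>n::nat. 1 / real (card (cluster_ball \<omega> 0 (real n))) *
       (\<Sum>x\<in>cluster_ball \<omega> 0 (real n). \<bar>1 / real n * chi j \<omega> x\<bar>)) \<longlonglongrightarrow> 0"
    using regular unfolding cocycle_def
  proof eventually_elim
    case (elim \<omega>)
    let ?avg = "\<lambda>n::nat. 1 / real (card (cluster_ball \<omega> 0 (real n))) *
       (\<Sum>x\<in>cluster_ball \<omega> 0 (real n). \<bar>1 / real n * chi j \<omega> x\<bar>)"
    obtain N0 where N0: "\<forall>n\<ge>N0. very_regular CV Criso CW \<theta> \<omega> n" using elim by blast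
    define W where "W = nat \<lceil>CW\<rceil>"
    have W: "CW \<le> real W" "1 \<le> W" using CW by (auto simp: W_def le_nat_iff)
    define C where "C = (3 + 2 * 2 ^ Suc CARD('d)) * (2 * real W ^ CARD('d) / Criso) / CV"
    have nonneg: "0 \<le> ?avg n" for n by (intro mult_nonneg_nonneg sum_nonneg) auto
    show "?avg \<longlonglongrightarrow> 0"
    proof (rule LIMSEQ_I)
      fix e :: real assume e: "0 < e"
      \<comment> \<open>The level \<open>k\<close> is fixed first; \<open>\<phi>\<close>,
        \<open>A\<close> and \<open>M\<close> may then depend on \<open>k\<close> and on the
        environment, whereas \<open>C\<close> does not depend on \<open>k\<close>.\<close>
      have "(\<lambda>k. C * (1 / real (Suc k))) \<longlonglongrightarrow> C * 0"
        using LIMSEQ_inverse_real_of_nat by (intro tendsto_intros) (simp add: inverse_eq_divide)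
      then have "\<forall>\<^sub>F k in sequentially. C * (1 / real (Suc k)) < e / 2"
        using e by (intro order_tendstoD(2)) auto
      then obtain k where k: "C * (1 / real (Suc k)) < e / 2"
        using eventually_happens sequentially_bot by blast
      obtain \<phi> where \<phi>: "bounded_local \<phi>" "\<forall>n\<ge>1. (\<Sum>x\<in>cube n. local_gradient
          (\<lambda>\<omega> x. chi j \<omega> x - D_grad \<phi> \<omega> x) (shift x \<omega>)) \<le> 1 / real (Suc k) * real n ^ CARD('d)"
        using elim unfolding small_def by blast
      obtain A where A: "\<forall>n\<ge>max 1 N0. ?avg n \<le> A / real n + C * (1 / real (Suc k))"
        using cluster_average_bound[OF CV(1) Criso W theta(2) _ _ _ N0 _ \<phi>] elim space_P
        unfolding C_def by auto
      have "(\<lambda>n. A / real n) \<longlonglongrightarrow> 0" by (rule lim_const_over_n)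
      then have "\<forall>\<^sub>F n in sequentially. A / real n < e / 2" using e by (intro order_tendstoD(2)) auto
      then obtain M where M: "\<And>n. M \<le> n \<Longrightarrow> A / real n < e / 2"
        unfolding eventually_sequentially by blast
      have "norm (?avg n - 0) < e" if "max M (max 1 N0) \<le> n" for n
      proof -
        have "?avg n \<le> A / real n + C * (1 / real (Suc k))" using A that by auto
        moreover have "A / real n < e / 2" using M that by simp
        ultimately have "?avg n < e" using k by linarith
        then show ?thesis unfolding diff_zero real_norm_def abs_of_nonneg[OF nonneg] .
      qed
      then show "\<exists>no. \<forall>n\<ge>no. norm (?avg n - 0) < e" by blast
    qed
  qed
qed

end
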